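(* Let $n \geq 1$ and let $A(2n+1) = \langle x, y \;\|\; (xy)^n x = (yx)^n y \rangle$ be the 2-generated Artin group. Let $\lambda,\mu\in\mathbb{C}$, $s \in \mathbb{C}^*$, and let $F_{2n}$, $\psi$, $\Sigma$ and $\sigma=\sigma(\lambda,\mu)$ be as defined in the context. Then the map $$\rho : A(2n+1) \to \mathrm{GL}_{4(2n+1)}(\mathbb{Z}[\lambda, \mu, s^{\pm 1}])$$ defined on the generators by $$ x^{\rho} = \left( \begin{array}{ccccc} \mathbf{0} & E_2 & \mathbf{0} & \cdots & \mathbf{0} \\ \mathbf{0} & \mathbf{0} & E_2 & \cdots & \mathbf{0} \\ \vdots & & & \ddots & \vdots \\ \mathbf{0} & \mathbf{0} & \mathbf{0} & \cdots & E_2 \\ s(\Sigma^{-1})^{\sigma} & \mathbf{0} & \mathbf{0} & \cdots & \mathbf{0} \end{array} \right), $$ $$ y^{\rho} = \left( \begin{array}{ccccc} \mathbf{0} & x_0^{\sigma} & \mathbf{0} & \cdots & \mathbf{0} \\ \mathbf{0} & \mathbf{0} & (\psi^{-1}(x_0))^{\sigma} & \cdots & \mathbf{0} \\ \vdots & & & \ddots & \vdots \\ \mathbf{0} & \mathbf{0} & \mathbf{0} & \cdots & (\psi^{-4n}(x_0))^{\sigma} \\ s \left( \Sigma^{-1} \psi(x_0) \right)^{\sigma} & \mathbf{0} & \mathbf{0} & \cdots & \mathbf{0} \end{array} \right) $$ is a linear representation of $A(2n+1)$. In this case, if $|\lambda| \geq 2$, $|\mu| \geq 2$ and $s$ is not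 a root of unity, then this representation is faithful.
   Context: $F_{2n}$ is the free group with free generators $x_0, x_1, \ldots, x_{2n-1}$, and $\psi$ is the automorphism of $F_{2n}$ given by $$\psi(x_0) = x_0 x_2 \cdots x_{2n-4} x_{2n-2}\, x_{2n-1}^{-1} x_{2n-3}^{-1}\cdots x_3^{-1} x_1^{-1}, \qquad \psi(x_i) = x_{i-1},\ i = 1, \ldots, 2n-1$$ (the product of all even-indexed generators in increasing order, followed by the inverses of all odd-indexed generators in decreasing order; for $n=1$, $\psi(x_0)=x_0x_1^{-1}$). Put $$\Sigma = x_0 x_2 \cdots x_{2n-2}\,(x_0 x_1 \cdots x_{2n-1})^{-1}\, x_1 x_3 \cdots x_{2n-1} \in F_{2n}.$$ The homomorphism $\sigma = \sigma(\lambda,\mu) : F_{2n} \to \mathrm{GL}_2(\mathbb{Z}[\lambda,\mu])$ is defined by $$x_i^{\sigma} = \left( \begin{array}{cc} 1 & \mu \\ 0 & 1 \end{array} \right)^{-i} \left( \begin{array}{cc} 1 & 0 \\ \lambda & 1 \end{array} \right) \left( \begin{array}{cc} 1 & \mu \\ 0 & 1 \end{array} \right)^{i}, \quad i = 0, 1, \ldots, 2n-1,$$ and $g^\sigma$ denotes the image of $g$ under $\sigma$. The matrices $x^\rho,y^\rho$ have $(4n+2)\times(4n+2)$ blocks of size $2\times 2$; $\mathbf{0}$ and $E_2$ are the zero and identity $2 \times 2$ matrices. The only nonzero blocks of $x^\rho$ are $E_2$ at positions $(i,i+1)$, $1\le i\le 4n+1$, and $s(\Sigma^{-1})^\sigma$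 at position $(4n+2,1)$; the only nonzero blocks of $y^\rho$ are $(\psi^{-(i-1)}(x_0))^\sigma$ at positions $(i,i+1)$, $1\le i\le 4n+1$, and $s(\Sigma^{-1}\psi(x_0))^\sigma$ at position $(4n+2,1)$. $\mathbb{Z}[\lambda,\mu,s^{\pm1}]$ is the subring of $\mathbb{C}$ generated by $\lambda,\mu,s,s^{-1}$. *)

theory Defs
  imports
    "Jordan_Normal_Form.VS_Connect"
    "HOL-Algebra.Generated_Rings"
begin

section \<open>Groups given by generators and relations\<close>

text \<open>A letter \<open>(a, True)\<close> stands for the generator \<open>a\<close>, and \<open>(a, False)\<close> for its inverse.\<close>

type_synonym 'g word = "('g \<times> bool) list"

abbreviation words :: "'g set \<Rightarrow> 'g word set" where
  "words S \<equiv> lists (S \<times> UNIV)"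

text \<open>The congruence on words generated by free cancellation and by the relations
  \<open>l = r\<close> for \<open>(l, r) \<in> R\<close>.\<close>

inductive_set pres_rel :: "'g set \<Rightarrow> ('g word \<times> 'g word) set \<Rightarrow> ('g word \<times> 'g word) set"
  for S and R where
    refl: "w \<in> words S \<Longrightarrow> (w, w) \<in> pres_rel S R"
  | sym: "(v, w) \<in> pres_rel S R \<Longrightarrow> (w, v) \<in> pres_rel S R"
  | trans: "(u, v) \<in> pres_rel S R \<Longrightarrow> (v, w) \<in> pres_rel S R \<Longrightarrow> (u, w) \<in> pres_rel S R"
  | cancel: "u \<in> words S \<Longrightarrow> v \<in> words S \<Longrightarrow> a \<in> S \<Longrightarrow>
      (u @ [(a, b), (a, \<not> b)] @ v, u @ v) \<in> pres_rel S R"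
  | relation: "u \<in> words S \<Longrightarrow> v \<in> words S \<Longrightarrow> (l, r) \<in> R \<Longrightarrow> l \<in> words S \<Longrightarrow> r \<in> words S \<Longrightarrow>
      (u @ l @ v, u @ r @ v) \<in> pres_rel S R"

definition presented_group :: "'g set \<Rightarrow> ('g word \<times> 'g word) set \<Rightarrow> 'g word set monoid" where
  "presented_group S R =
    \<lparr> carrier = words S // pres_rel S R,
      monoid.mult = (\<lambda>c d. \<Union>u\<in>c. \<Union>v\<in>d. pres_rel S R `` {u @ v}),
      one = pres_rel S R `` {[]} \<rparr>"

definition pres_gen :: "'g set \<Rightarrow> ('g word \<times> 'g word) set \<Rightarrow> 'g \<Rightarrow> 'g word set" where
  "pres_gen S R a = pres_rel S R `` {[(a, True)]}"

definition gprod :: "('a, 'b) monoid_scheme \<Rightarrow> 'a list \<Rightarrow> 'a" where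
  "gprod G gs = foldr (\<lambda>g h. g \<otimes>\<^bsub>G\<^esub> h) gs \<one>\<^bsub>G\<^esub>"

definition word_eval :: "('h, 'b) monoid_scheme \<Rightarrow> ('g \<Rightarrow> 'h) \<Rightarrow> 'g word \<Rightarrow> 'h" where
  "word_eval G f w = gprod G (map (\<lambda>(a, b). if b then f a else inv\<^bsub>G\<^esub> (f a)) w)"

text \<open>The homomorphism on a presented group that extends \<open>f\<close>, for \<open>f\<close> respecting the
  relations (see \<open>pres_lift_hom\<close> and \<open>pres_lift_gen\<close> below).\<close>

definition pres_lift :: "('h, 'b) monoid_scheme \<Rightarrow> ('g \<Rightarrow> 'h) \<Rightarrow> 'g word set \<Rightarrow> 'h" where
  "pres_lift G f c = the_elem (word_eval G f ` c)"

lemma pres_rel_words: "(v, w) \<in> pres_rel S R \<Longrightarrow> v \<in> words S \<and> w \<in> words S"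
  by (induction rule: pres_rel.induct) auto

lemma equiv_pres_rel: "equiv (words S) (pres_rel S R)"
proof (rule equivI)
  show "pres_rel S R \<subseteq> words S \<times> words S"
    using pres_rel_words by fast
  show "refl_on (words S) (pres_rel S R)"
    unfolding refl_on_def using pres_rel.refl by blast
  show "sym (pres_rel S R)"
    by (rule symI) (rule pres_rel.sym)
  show "trans (pres_rel S R)"
    by (rule transI) (rule pres_rel.trans)
qed

lemma pres_rel_append_left:
  "(v, w) \<in> pres_rel S R \<Longrightarrow> u \<in> words S \<Longrightarrow> (u @ v, u @ w) \<in> pres_rel S R"
proof (induction rule: pres_rel.induct)
  case (refl w)
  then show ?case by (intro pres_rel.refl) simp
next
  case (sym v w)
  show ?case using sym.IH[OF sym.prems] by (rule pres_rel.sym)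
next
  case (trans v w x)
  show ?case using trans.IH(1)[OF trans.prems] trans.IH(2)[OF trans.prems] by (rule pres_rel.trans)
next
  case (cancel u' v a b)
  then show ?case using pres_rel.cancel[of "u @ u'" S v a b R] by simp
next
  case (relation u' v l r)
  then show ?case using pres_rel.relation[of "u @ u'" S v l r R] by simp
qed

lemma pres_rel_append_right:
  "(v, w) \<in> pres_rel S R \<Longrightarrow> u \<in> words S \<Longrightarrow> (v @ u, w @ u) \<in> pres_rel S R"
proof (induction rule: pres_rel.induct)
  case (refl w)
  then show ?case by (intro pres_rel.refl) simp
next
  case (sym v w)
  show ?case using sym.IH[OF sym.prems] by (rule pres_rel.sym)
next
  case (trans v w x)
  show ?case using trans.IH(1)[OF trans.prems] trans.IH(2)[OF trans.prems] by (rule pres_rel.trans)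
next
  case (cancel u' v a b)
  then show ?case using pres_rel.cancel[of u' S "v @ u" a b R] by simp
next
  case (relation u' v l r)
  then show ?case using pres_rel.relation[of u' S "v @ u" l r R] by simp
qed

lemma pres_rel_append:
  assumes "(u, u') \<in> pres_rel S R" "(v, v') \<in> pres_rel S R"
  shows "(u @ v, u' @ v') \<in> pres_rel S R"
proof (rule pres_rel.trans)
  show "(u @ v, u' @ v) \<in> pres_rel S R"
    using pres_rel_append_right[OF assms(1)] pres_rel_words[OF assms(2)] by blast
  show "(u' @ v, u' @ v') \<in> pres_rel S R"
    using pres_rel_append_left[OF assms(2)] pres_rel_words[OF assms(1)] by blast
qed

lemma pres_mult_class:
  assumes "u \<in> words S" "v \<in> words S"
  shows "pres_rel S R `` {u} \<otimes>\<^bsub>presented_group S R\<^esub> pres_rel S R `` {v} = pres_rel S R `` {u @ v}"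
proof -
  have *: "pres_rel S R `` {u' @ v'} = pres_rel S R `` {u @ v}"
    if "u' \<in> pres_rel S R `` {u}" "v' \<in> pres_rel S R `` {v}" for u' v'
    using that equiv_class_eq[OF equiv_pres_rel pres_rel_append, of u u' S R v v'] by simp
  have "(\<Union>u'\<in>pres_rel S R `` {u}. \<Union>v'\<in>pres_rel S R `` {v}. pres_rel S R `` {u' @ v'}) =
      (\<Union>u'\<in>pres_rel S R `` {u}. \<Union>v'\<in>pres_rel S R `` {v}. pres_rel S R `` {u @ v})"
    by (rule SUP_cong[OF HOL.refl], rule SUP_cong[OF HOL.refl], rule *)
  also have "\<dots> = pres_rel S R `` {u @ v}"
    using pres_rel.refl[OF assms(1), of R] pres_rel.refl[OF assms(2), of R] by blast
  finally show ?thesis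
    by (simp add: presented_group_def)
qed

lemma pres_carrier_iff:
  "c \<in> carrier (presented_group S R) \<longleftrightarrow> (\<exists>w\<in>words S. c = pres_rel S R `` {w})"
  by (auto simp: presented_group_def quotient_def)

lemma pres_one: "\<one>\<^bsub>presented_group S R\<^esub> = pres_rel S R `` {[]}"
  by (simp add: presented_group_def)

lemma pres_class_closed: "w \<in> words S \<Longrightarrow> pres_rel S R `` {w} \<in> carrier (presented_group S R)"
  unfolding presented_group_def by (simp add: quotientI del: in_lists_conv_set)

lemma group_presented_group: "group (presented_group S R)" (is "group ?G")
proof (rule groupI)
  let ?i = "\<lambda>w. rev (map (\<lambda>(a, b). (a, \<not> b)) w)"
  have inv_words: "?i w \<in> words S" if "w \<in> words S" for w
    using that by (induction w) auto
  have inv_rel: "(?i w @ w, []) \<in> pres_rel S R" if "w \<in> words S" for w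
    using that
  proof (induction w rule: lists.induct)
    case Nil
    show ?case by (simp add: pres_rel.refl)
  next
    case (Cons x w)
    obtain a b where x: "x = (a, b)" by (cases x)
    have "(?i w @ [(a, \<not> b), (a, \<not> \<not> b)] @ w, ?i w @ w) \<in> pres_rel S R"
      using Cons.hyps x inv_words[OF Cons.hyps(2)] by (intro pres_rel.cancel) auto
    then have "(?i (x # w) @ x # w, ?i w @ w) \<in> pres_rel S R"
      using x by simp
    then show ?case using Cons.IH by (rule pres_rel.trans)
  qed
  show "\<one>\<^bsub>?G\<^esub> \<in> carrier ?G"
    unfolding pres_one by (rule pres_class_closed) simp
  fix c assume "c \<in> carrier ?G"
  then obtain u where u: "u \<in> words S" "c = pres_rel S R `` {u}"
    unfolding pres_carrier_iff by blast
  have nil: "[] \<in> words S" by simp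
  show "\<one>\<^bsub>?G\<^esub> \<otimes>\<^bsub>?G\<^esub> c = c"
    unfolding u(2) pres_one pres_mult_class[OF nil u(1)] by simp
  show "\<exists>c'\<in>carrier ?G. c' \<otimes>\<^bsub>?G\<^esub> c = \<one>\<^bsub>?G\<^esub>"
  proof (rule bexI)
    show "pres_rel S R `` {?i u} \<otimes>\<^bsub>?G\<^esub> c = \<one>\<^bsub>?G\<^esub>"
      unfolding u(2) pres_one pres_mult_class[OF inv_words[OF u(1)] u(1)]
      by (rule equiv_class_eq[OF equiv_pres_rel inv_rel[OF u(1)]])
    show "pres_rel S R `` {?i u} \<in> carrier ?G"
      by (rule pres_class_closed[OF inv_words[OF u(1)]])
  qed
  fix d assume "d \<in> carrier ?G"
  then obtain v where v: "v \<in> words S" "d = pres_rel S R `` {v}"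
    unfolding pres_carrier_iff by blast
  have uv: "u @ v \<in> words S" using u(1) v(1) by simp
  show "c \<otimes>\<^bsub>?G\<^esub> d \<in> carrier ?G"
    unfolding u(2) v(2) pres_mult_class[OF u(1) v(1)] by (rule pres_class_closed[OF uv])
  fix e assume "e \<in> carrier ?G"
  then obtain w where w: "w \<in> words S" "e = pres_rel S R `` {w}"
    unfolding pres_carrier_iff by blast
  have vw: "v @ w \<in> words S" using v(1) w(1) by simp
  show "c \<otimes>\<^bsub>?G\<^esub> d \<otimes>\<^bsub>?G\<^esub> e = c \<otimes>\<^bsub>?G\<^esub> (d \<otimes>\<^bsub>?G\<^esub> e)"
    unfolding u(2) v(2) w(2) pres_mult_class[OF u(1) v(1)] pres_mult_class[OF v(1) w(1)]
      pres_mult_class[OF uv w(1)] pres_mult_class[OF u(1) vw] by simp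
qed

lemma (in group) word_eval_closed:
  "\<forall>a\<in>S. f a \<in> carrier G \<Longrightarrow> w \<in> words S \<Longrightarrow> word_eval G f w \<in> carrier G"
  by (induction w) (auto simp: word_eval_def gprod_def)

lemma (in group) word_eval_append:
  assumes "\<forall>a\<in>S. f a \<in> carrier G" "u \<in> words S" "v \<in> words S"
  shows "word_eval G f (u @ v) = word_eval G f u \<otimes> word_eval G f v"
  using assms(2)
proof (induction u)
  case Nil
  then show ?case using word_eval_closed[OF assms(1,3)] by (simp add: word_eval_def gprod_def)
next
  case (Cons x u)
  then show ?case
    using word_eval_closed[OF assms(1,3)] word_eval_closed[OF assms(1), of u] assms(1)
    by (auto simp: word_eval_def gprod_def m_assoc)
qed

lemma (in group) word_eval_respects:
  assumes "\<forall>a\<in>S. f a \<in> carrier G" and "\<forall>(l, r)\<in>R. word_eval G f l = word_eval G f r"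
    and "(v, w) \<in> pres_rel S R"
  shows "word_eval G f v = word_eval G f w"
  using assms(3)
proof (induction rule: pres_rel.induct)
  case (cancel u v a b)
  let ?p = "[(a, b), (a, \<not> b)]"
  have p: "?p \<in> words S" and pv: "?p @ v \<in> words S" using cancel by auto
  have "word_eval G f ?p = \<one>"
    using cancel(3) assms(1) by (auto simp: word_eval_def gprod_def)
  then have "word_eval G f (?p @ v) = word_eval G f v"
    unfolding word_eval_append[OF assms(1) p cancel(2)]
    using word_eval_closed[OF assms(1) cancel(2)] by simp
  then show ?case
    unfolding word_eval_append[OF assms(1) cancel(1) pv]
      word_eval_append[OF assms(1) cancel(1,2)] by simp
next
  case (relation u v l r)
  have lv: "l @ v \<in> words S" and rv: "r @ v \<in> words S" using relation by auto
  have "word_eval G f l = word_eval G f r" using relation(3) assms(2) by blast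
  then show ?case
    unfolding word_eval_append[OF assms(1) relation(1) lv] word_eval_append[OF assms(1) relation(1) rv]
      word_eval_append[OF assms(1) relation(4,2)] word_eval_append[OF assms(1) relation(5,2)] by simp
qed auto

lemma (in group) pres_lift_class:
  assumes "\<forall>a\<in>S. f a \<in> carrier G" and "\<forall>(l, r)\<in>R. word_eval G f l = word_eval G f r"
    and "w \<in> words S"
  shows "pres_lift G f (pres_rel S R `` {w}) = word_eval G f w"
  unfolding pres_lift_def
proof (rule the_elem_image_unique)
  show "pres_rel S R `` {w} \<noteq> {}" using pres_rel.refl[OF assms(3)] by blast
  show "word_eval G f v = word_eval G f w" if "v \<in> pres_rel S R `` {w}" for v
    using that word_eval_respects[OF assms(1,2)] by fastforce
qed

lemma (in group) pres_lift_hom: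
  assumes "\<forall>a\<in>S. f a \<in> carrier G" and "\<forall>(l, r)\<in>R. word_eval G f l = word_eval G f r"
  shows "pres_lift G f \<in> hom (presented_group S R) G"
proof (rule homI)
  fix c assume "c \<in> carrier (presented_group S R)"
  then obtain u where u: "u \<in> words S" "c = pres_rel S R `` {u}"
    unfolding pres_carrier_iff by blast
  show "pres_lift G f c \<in> carrier G"
    unfolding u(2) pres_lift_class[OF assms u(1)] by (rule word_eval_closed[OF assms(1) u(1)])
  fix d assume "d \<in> carrier (presented_group S R)"
  then obtain v where v: "v \<in> words S" "d = pres_rel S R `` {v}"
    unfolding pres_carrier_iff by blast
  have uv: "u @ v \<in> words S" using u(1) v(1) by simp
  show "pres_lift G f (c \<otimes>\<^bsub>presented_group S R\<^esub> d) = pres_lift G f c \<otimes> pres_lift G f d"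
    unfolding u(2) v(2) pres_mult_class[OF u(1) v(1)] pres_lift_class[OF assms uv]
      pres_lift_class[OF assms u(1)] pres_lift_class[OF assms v(1)]
    by (rule word_eval_append[OF assms(1) u(1) v(1)])
qed

lemma (in group) pres_lift_gen:
  assumes "\<forall>a\<in>S. f a \<in> carrier G" and "\<forall>(l, r)\<in>R. word_eval G f l = word_eval G f r"
    and "a \<in> S"
  shows "pres_lift G f (pres_gen S R a) = f a"
  unfolding pres_gen_def using assms(1,3)
  by (subst pres_lift_class[OF assms(1,2)]) (auto simp: word_eval_def gprod_def)

section \<open>The free group and its automorphism\<close>

abbreviation free_group :: "'g set \<Rightarrow> 'g word set monoid" where
  "free_group S \<equiv> presented_group S {}"

abbreviation FG :: "nat \<Rightarrow> nat word set monoid" where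
  "FG n \<equiv> free_group {..<2 * n}"

definition fgen :: "nat \<Rightarrow> nat \<Rightarrow> nat word set" where
  "fgen n i = pres_gen {..<2 * n} {} i"

definition psi :: "nat \<Rightarrow> nat word set \<Rightarrow> nat word set" where
  "psi n = pres_lift (FG n) (\<lambda>i.
     if i = 0 then
       gprod (FG n) (map (\<lambda>k. fgen n (2 * k)) [0..<n] @
                    map (\<lambda>k. inv\<^bsub>FG n\<^esub> (fgen n (2 * k + 1))) (rev [0..<n]))
     else fgen n (i - 1))"

definition psi_inv :: "nat \<Rightarrow> nat word set \<Rightarrow> nat word set" where
  "psi_inv n = inv_into (carrier (FG n)) (psi n)"

definition Sigma_elt :: "nat \<Rightarrow> nat word set" where
  "Sigma_elt n =
     gprod (FG n) (map (\<lambda>k. fgen n (2 * k)) [0..<n]) \<otimes>\<^bsub>FG n\<^esub>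
     inv\<^bsub>FG n\<^esub> (gprod (FG n) (map (fgen n) [0..<2 * n])) \<otimes>\<^bsub>FG n\<^esub>
     gprod (FG n) (map (\<lambda>k. fgen n (2 * k + 1)) [0..<n])"

section \<open>Linear groups over subrings of the complex numbers\<close>

definition adjoin :: "complex set \<Rightarrow> complex set" where
  "adjoin A = generate_ring class_ring A"

definition GL :: "nat \<Rightarrow> complex set \<Rightarrow> complex mat monoid" where
  "GL m R = units_of
     (ring_mat TYPE(complex) m () \<lparr> carrier := {M \<in> carrier_mat m m. elements_mat M \<subseteq> R} \<rparr>)"

definition sigma :: "nat \<Rightarrow> complex \<Rightarrow> complex \<Rightarrow> nat word set \<Rightarrow> complex mat" where
  "sigma n lam mu =
     (let G = GL 2 (adjoin {lam, mu});
          U = mat_of_rows_list 2 [[1, mu], [0, 1]];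
          L = mat_of_rows_list 2 [[1, 0], [lam, 1]]
      in pres_lift G (\<lambda>i. U [^]\<^bsub>G\<^esub> (- int i) \<otimes>\<^bsub>G\<^esub> L \<otimes>\<^bsub>G\<^esub> U [^]\<^bsub>G\<^esub> (int i)))"

section \<open>The Artin group and its representation\<close>

datatype artin_gen = GenX | GenY

abbreviation artin_rels :: "nat \<Rightarrow> (artin_gen word \<times> artin_gen word) set" where
  "artin_rels n \<equiv>
     {(concat (replicate n [(GenX, True), (GenY, True)]) @ [(GenX, True)],
       concat (replicate n [(GenY, True), (GenX, True)]) @ [(GenY, True)])}"

text \<open>This is $A(2n+1)$.\<close>

definition artin_group :: "nat \<Rightarrow> artin_gen word set monoid" where
  "artin_group n = presented_group {GenX, GenY} (artin_rels n)"

definition artin_x :: "nat \<Rightarrow> artin_gen word set" where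
  "artin_x n = pres_gen {GenX, GenY} (artin_rels n) GenX"

definition artin_y :: "nat \<Rightarrow> artin_gen word set" where
  "artin_y n = pres_gen {GenX, GenY} (artin_rels n) GenY"

text \<open>The matrix with \<open>N \<times> N\<close> blocks of size \<open>2 \<times> 2\<close>. Block positions, like matrix
  positions, count from 0, so the informal block position $(i,j)$ is \<open>(i - 1, j - 1)\<close> here.\<close>

definition block_mat :: "nat \<Rightarrow> (nat \<Rightarrow> nat \<Rightarrow> complex mat) \<Rightarrow> complex mat" where
  "block_mat N B = mat (2 * N) (2 * N) (\<lambda>(i, j). B (i div 2) (j div 2) $$ (i mod 2, j mod 2))"

definition rho_x :: "nat \<Rightarrow> complex \<Rightarrow> complex \<Rightarrow> complex \<Rightarrow> complex mat" where
  "rho_x n lam mu s = block_mat (4 * n + 2) (\<lambda>i j.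
     if j = i + 1 then 1\<^sub>m 2
     else if i = 4 * n + 1 \<and> j = 0 then s \<cdot>\<^sub>m sigma n lam mu (inv\<^bsub>FG n\<^esub> (Sigma_elt n))
     else 0\<^sub>m 2 2)"

definition rho_y :: "nat \<Rightarrow> complex \<Rightarrow> complex \<Rightarrow> complex \<Rightarrow> complex mat" where
  "rho_y n lam mu s = block_mat (4 * n + 2) (\<lambda>i j.
     if j = i + 1 then sigma n lam mu ((psi_inv n ^^ i) (fgen n 0))
     else if i = 4 * n + 1 \<and> j = 0 then
       s \<cdot>\<^sub>m sigma n lam mu (inv\<^bsub>FG n\<^esub> (Sigma_elt n) \<otimes>\<^bsub>FG n\<^esub> psi n (fgen n 0))
     else 0\<^sub>m 2 2)"

definition rho :: "nat \<Rightarrow> complex \<Rightarrow> complex \<Rightarrow> complex \<Rightarrow> artin_gen word set \<Rightarrow> complex mat" where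
  "rho n lam mu s = pres_lift (GL (4 * (2 * n + 1)) (adjoin {lam, mu, s, inverse s}))
     (\<lambda>g. case g of GenX \<Rightarrow> rho_x n lam mu s | GenY \<Rightarrow> rho_y n lam mu s)"

end

theory Submission
  imports Defs "Jordan_Normal_Form.Determinant"
begin

text \<open>Write \<open>N = 4n + 2\<close> and let \<open>x\<close> act on \<open>F\<^sub>2\<^sub>n\<close> by \<open>\<chi> = \<psi>\<inverse>\<close>, continuing the generators by
  \<open>x\<^sub>k = \<chi>\<^sup>k(x\<^sub>0)\<close>. With \<open>P\<^sub>k = x\<^sub>k x\<^sub>k\<^sub>+\<^sub>2 \<cdots> x\<^sub>k\<^sub>+\<^sub>2\<^sub>n\<^sub>-\<^sub>2\<close> one has \<open>P\<^sub>k x\<^sub>k\<^sub>+\<^sub>2\<^sub>n = P\<^sub>k\<^sub>+\<^sub>1 = x\<^sub>k P\<^sub>k\<^sub>+\<^sub>2\<close>, hence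
  \<open>\<Sigma> = P\<^sub>0 P\<^sub>2\<^sub>n\<^sub>+\<^sub>1\<close> is fixed by \<open>\<chi>\<close>, and \<open>\<chi>\<^sup>N\<close> is conjugation by \<open>\<Sigma>\<inverse>\<close>.
  For \<open>D(g) = diag(\<sigma>(\<chi>\<^sup>i g))\<^sub>i\<^sub><\<^sub>N\<close> this gives \<open>x\<^sup>\<rho> D(g) = D(\<chi> g) x\<^sup>\<rho>\<close> and \<open>y\<^sup>\<rho> = D(x\<^sub>0) x\<^sup>\<rho>\<close>.
  The Artin relation says exactly \<open>P\<^sub>1 = P\<^sub>0 x\<^sub>2\<^sub>n\<close>, where \<open>x\<^sub>k\<close> stands for \<open>x\<^sup>k (y x\<inverse>) x\<^sup>-\<^sup>k\<close>, so \<open>\<rho>\<close> exists; and every element of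
  the Artin group has the form \<open>g x\<^sup>k\<close> with \<open>g\<close> coming from \<open>F\<^sub>2\<^sub>n\<close>.
  If its image is the identity, the block pattern gives \<open>k = Nq\<close>, so that \<open>s\<^sup>q \<sigma>(g \<Sigma>\<^sup>-\<^sup>q) = E\<^sub>2\<close>; determinants
  yield \<open>s\<^sup>2\<^sup>q = 1\<close>, so \<open>q = 0\<close>, and \<open>g = 1\<close> because \<open>\<sigma>\<close> is faithful by ping-pong.\<close>

section \<open>Products and homomorphisms\<close>

lemma (in group) inv_cancel_left [simp]:
  assumes "x \<in> carrier G" "y \<in> carrier G"
  shows "inv x \<otimes> (x \<otimes> y) = y" "x \<otimes> (inv x \<otimes> y) = y"
  using assms by (simp_all flip: m_assoc)

lemma gprod_Nil [simp]: "gprod G [] = \<one>\<^bsub>G\<^esub>"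
  and gprod_Cons [simp]: "gprod G (g # gs) = g \<otimes>\<^bsub>G\<^esub> gprod G gs"
  by (simp_all add: gprod_def)

lemma (in group) gprod_closed [intro, simp]: "set gs \<subseteq> carrier G \<Longrightarrow> gprod G gs \<in> carrier G"
  by (induction gs) auto

lemma (in group) gprod_map_closed [intro, simp]:
  "(\<And>k. k \<in> set ks \<Longrightarrow> f k \<in> carrier G) \<Longrightarrow> gprod G (map f ks) \<in> carrier G"
  by (rule gprod_closed) auto

lemma (in group) gprod_append:
  "set gs \<subseteq> carrier G \<Longrightarrow> set hs \<subseteq> carrier G \<Longrightarrow> gprod G (gs @ hs) = gprod G gs \<otimes> gprod G hs"
  by (induction gs) (auto simp: m_assoc)

lemma (in group) gprod_rev_inv:
  "set gs \<subseteq> carrier G \<Longrightarrow> gprod G (map (\<lambda>g. inv g) (rev gs)) = inv (gprod G gs)"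
  by (induction gs) (auto simp: gprod_append inv_mult_group image_subset_iff subset_eq)

lemma (in group_hom) hom_gprod: "set gs \<subseteq> carrier G \<Longrightarrow> h (gprod G gs) = gprod H (map h gs)"
  by (induction gs) auto

section \<open>Generators of presented groups, induction over letters, equality of
  homomorphisms\<close>

lemma pres_gen_closed: "a \<in> S \<Longrightarrow> pres_gen S R a \<in> carrier (presented_group S R)"
  unfolding pres_gen_def by (rule pres_class_closed) auto

lemma inv_pres_gen:
  assumes "a \<in> S"
  shows "inv\<^bsub>presented_group S R\<^esub> (pres_gen S R a) = pres_rel S R `` {[(a, False)]}"
proof -
  interpret P: group "presented_group S R" by (rule group_presented_group)
  have w: "[(a, True)] \<in> words S" "[(a, False)] \<in> words S" using assms by auto
  have "([(a, False), (a, True)], []) \<in> pres_rel S R"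
    using pres_rel.cancel[of "[]" S "[]" a False R] assms by simp
  then have "pres_rel S R `` {[(a, False)]} \<otimes>\<^bsub>presented_group S R\<^esub> pres_gen S R a = \<one>\<^bsub>presented_group S R\<^esub>"
    unfolding pres_gen_def pres_mult_class[OF w(2,1)] pres_one
    by (simp add: equiv_class_eq[OF equiv_pres_rel])
  then show ?thesis
    using P.inv_equality pres_gen_closed[OF assms] pres_class_closed[OF w(2)] by blast
qed

lemma presented_group_induct [consumes 1, case_names one gen inv_gen]:
  assumes "c \<in> carrier (presented_group S R)"
    and "P \<one>\<^bsub>presented_group S R\<^esub>"
    and "\<And>a c. a \<in> S \<Longrightarrow> c \<in> carrier (presented_group S R) \<Longrightarrow> P c \<Longrightarrow>
      P (pres_gen S R a \<otimes>\<^bsub>presented_group S R\<^esub> c)"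
    and "\<And>a c. a \<in> S \<Longrightarrow> c \<in> carrier (presented_group S R) \<Longrightarrow> P c \<Longrightarrow>
      P (inv\<^bsub>presented_group S R\<^esub> (pres_gen S R a) \<otimes>\<^bsub>presented_group S R\<^esub> c)"
  shows "P c"
proof -
  obtain w where w: "w \<in> words S" "c = pres_rel S R `` {w}"
    using assms(1) unfolding pres_carrier_iff by blast
  have "P (pres_rel S R `` {w})"
    using w(1)
  proof (induction w rule: lists.induct)
    case Nil
    then show ?case using assms(2) by (simp add: pres_one)
  next
    case (Cons x w)
    obtain a b where x: "x = (a, b)" by (cases x)
    have a: "a \<in> S" using Cons x by auto
    have "[(a, b)] \<in> words S" using a by auto
    from pres_mult_class[OF this Cons.hyps(2), of R]
    have "pres_rel S R `` {x # w} = pres_rel S R `` {[(a, b)]} \<otimes>\<^bsub>presented_group S R\<^esub> pres_rel S R `` {w}"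
      using x by simp
    moreover have "pres_rel S R `` {w} \<in> carrier (presented_group S R)"
      by (rule pres_class_closed[OF Cons.hyps(2)])
    ultimately show ?case
      using assms(3,4)[OF a] Cons.IH inv_pres_gen[OF a, of R]
      by (cases b) (auto simp: pres_gen_def)
  qed
  then show ?thesis using w by simp
qed

lemma presented_group_hom_eqI:
  assumes G: "group G"
    and h: "h \<in> hom (presented_group S R) G" and h': "h' \<in> hom (presented_group S R) G"
    and eq: "\<And>a. a \<in> S \<Longrightarrow> h (pres_gen S R a) = h' (pres_gen S R a)"
    and c: "c \<in> carrier (presented_group S R)"
  shows "h c = h' c"
proof -
  interpret h: group_hom "presented_group S R" G h
    using G h group_presented_group by (simp add: group_hom_def group_hom_axioms_def)
  interpret h': group_hom "presented_group S R" G h'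
    using G h' group_presented_group by (simp add: group_hom_def group_hom_axioms_def)
  show ?thesis
    using c
    by (induction rule: presented_group_induct) (simp_all add: eq pres_gen_closed)
qed

lemma (in group)
  assumes "\<forall>a\<in>S. f a \<in> carrier G"
  shows free_lift_hom: "pres_lift G f \<in> hom (free_group S) G"
    and free_lift_gen: "a \<in> S \<Longrightarrow> pres_lift G f (pres_gen S {} a) = f a"
  using pres_lift_hom[OF assms, of "{}"] pres_lift_gen[OF assms, of "{}"] by simp_all

section \<open>The Artin relation in terms of conjugates\<close>

text \<open>In the Artin group these elements lie in the kernel of the homomorphism to the integers
  that sends both generators to 1; they are the intended images of the free generators
  \<open>x_k\<close>.\<close>

definition conj_gen :: "('a, 'b) monoid_scheme \<Rightarrow> 'a \<Rightarrow> 'a \<Rightarrow> nat \<Rightarrow> 'a" where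
  "conj_gen G x y k = x [^]\<^bsub>G\<^esub> k \<otimes>\<^bsub>G\<^esub> (y \<otimes>\<^bsub>G\<^esub> inv\<^bsub>G\<^esub> x) \<otimes>\<^bsub>G\<^esub> inv\<^bsub>G\<^esub> (x [^]\<^bsub>G\<^esub> k)"

context group
begin

context
  fixes x y
  assumes xy [simp]: "x \<in> carrier G" "y \<in> carrier G"
begin

lemma conj_gen_closed [simp]: "conj_gen G x y k \<in> carrier G"
  by (simp add: conj_gen_def)

text \<open>Rule for collecting conjugates on the left: a \<open>y\<close> behind \<open>k\<close>
  letters \<open>x\<close> turns into one conjugate followed by one more \<open>x\<close>.\<close>

lemma conj_gen_mult_pow: "conj_gen G x y k \<otimes> x [^] Suc k = x [^] k \<otimes> y"
  by (simp add: conj_gen_def m_assoc)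

text \<open>Reading from the left, a \<open>y\<close> preceded by \<open>j\<close> letters yields
  the conjugate of index \<open>j\<close>. These positions are odd in powers of
  \<open>x \<otimes> y\<close> and even in powers of \<open>y \<otimes> x\<close>, which
  \<open>pow_yx\<close> treats.\<close>

lemma pow_xy: "(x \<otimes> y) [^] m = gprod G (map (\<lambda>k. conj_gen G x y (2 * k + 1)) [0..<m]) \<otimes> x [^] (2 * m)"
proof (induction m)
  case 0
  show ?case by simp
next
  case (Suc m)
  let ?p = "gprod G (map (\<lambda>k. conj_gen G x y (2 * k + 1)) [0..<m])"
  have [simp]: "?p \<in> carrier G" by simp
  have "(x \<otimes> y) [^] Suc m = ?p \<otimes> (x [^] Suc (2 * m) \<otimes> y)"
    using Suc by (simp add: m_assoc)
  also have "x [^] Suc (2 * m) \<otimes> y = conj_gen G x y (2 * m + 1) \<otimes> x [^] (2 * Suc m)"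
    using conj_gen_mult_pow[of "Suc (2 * m)"] by simp
  finally show ?case
    by (simp add: gprod_append image_subset_iff m_assoc del: nat_pow_Suc)
qed

lemma pow_yx: "(y \<otimes> x) [^] m = gprod G (map (\<lambda>k. conj_gen G x y (2 * k)) [0..<m]) \<otimes> x [^] (2 * m)"
proof (induction m)
  case 0
  show ?case by simp
next
  case (Suc m)
  let ?p = "gprod G (map (\<lambda>k. conj_gen G x y (2 * k)) [0..<m])"
  have [simp]: "?p \<in> carrier G" by simp
  have "(y \<otimes> x) [^] Suc m = ?p \<otimes> (x [^] (2 * m) \<otimes> y) \<otimes> x"
    using Suc by (simp add: m_assoc)
  also have "x [^] (2 * m) \<otimes> y = conj_gen G x y (2 * m) \<otimes> x [^] Suc (2 * m)"
    using conj_gen_mult_pow[of "2 * m"] by simp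
  finally show ?case
    by (simp add: gprod_append image_subset_iff m_assoc)
qed

text \<open>Both words have \<open>2 * m + 1\<close> letters, so after collection they end in the
  same power of \<open>x\<close>, which cancels. The factor \<open>?d\<close> comes from the final
  \<open>y\<close> of the right-hand word.\<close>

lemma artin_relation_iff:
  "(x \<otimes> y) [^] m \<otimes> x = (y \<otimes> x) [^] m \<otimes> y \<longleftrightarrow>
    gprod G (map (\<lambda>k. conj_gen G x y (2 * k + 1)) [0..<m]) =
    gprod G (map (\<lambda>k. conj_gen G x y (2 * k)) [0..<m]) \<otimes> conj_gen G x y (2 * m)" (is "?l \<longleftrightarrow> ?p = ?q \<otimes> ?d")
proof -
  have [simp]: "?p \<in> carrier G" "?q \<in> carrier G" by simp_all
  have "(x \<otimes> y) [^] m \<otimes> x = ?p \<otimes> x [^] Suc (2 * m)"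
    unfolding pow_xy by (simp add: m_assoc)
  moreover have "(y \<otimes> x) [^] m \<otimes> y = (?q \<otimes> ?d) \<otimes> x [^] Suc (2 * m)"
    unfolding pow_yx using conj_gen_mult_pow[of "2 * m"] by (simp add: m_assoc)
  ultimately show ?thesis
    by (simp del: nat_pow_Suc)
qed

end

lemma word_eval_alternating:
  assumes "f a \<in> carrier G" "f b \<in> carrier G"
  shows "word_eval G f (concat (replicate m [(a, True), (b, True)]) @ [(a, True)]) =
    (f a \<otimes> f b) [^] m \<otimes> f a"
proof (induction m)
  case 0
  show ?case using assms by (simp add: word_eval_def)
next
  case (Suc m)
  then show ?case
    using assms nat_pow_Suc2[of "f a \<otimes> f b" m] by (simp add: word_eval_def m_assoc)
qed

end

section \<open>The inverse of the automorphism\<close>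

text \<open>Candidate for the inverse of \<open>psi\<close>, given on generators so that it is a
  homomorphism by construction. The value at the last generator is the solution
  \<open>x_(2n)\<close> of \<open>P_0 x_(2n) = P_1\<close>.\<close>

definition chi :: "nat \<Rightarrow> nat word set \<Rightarrow> nat word set" where
  "chi n = pres_lift (FG n) (\<lambda>i.
     if Suc i < 2 * n then fgen n (Suc i)
     else inv\<^bsub>FG n\<^esub> (gprod (FG n) (map (\<lambda>k. fgen n (2 * k)) [0..<n])) \<otimes>\<^bsub>FG n\<^esub>
       gprod (FG n) (map (\<lambda>k. fgen n (2 * k + 1)) [0..<n]))"

definition free_seq :: "nat \<Rightarrow> nat \<Rightarrow> nat word set" where
  "free_seq n k = (chi n ^^ k) (fgen n 0)"

text \<open>This is the product \<open>P_k\<close> of the overview.\<close>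

definition alt_prod :: "nat \<Rightarrow> nat \<Rightarrow> nat word set" where
  "alt_prod n k = gprod (FG n) (map (\<lambda>j. free_seq n (k + 2 * j)) [0..<n])"

lemma funpow_swap: "(f ^^ j) ((f ^^ k) z) = (f ^^ k) ((f ^^ j) z)"
proof -
  have "(f ^^ (j + k)) z = (f ^^ (k + j)) z" by (simp add: add.commute)
  then show ?thesis by (simp only: funpow_add comp_apply)
qed

locale odd_artin =
  fixes n :: nat
  assumes n_pos: "1 \<le> n"
begin

abbreviation F where "F \<equiv> FG n"

sublocale F: group F
  by (rule group_presented_group)

lemma fgen_closed [simp]: "i < 2 * n \<Longrightarrow> fgen n i \<in> carrier F"
  by (simp add: fgen_def pres_gen_closed)

lemma free_hom_eqI:
  assumes "group G" "h \<in> hom F G" "h' \<in> hom F G"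
    and "\<And>i. i < 2 * n \<Longrightarrow> h (fgen n i) = h' (fgen n i)" and "c \<in> carrier F"
  shows "h c = h' c"
  using presented_group_hom_eqI[OF assms(1-3) _ assms(5)] assms(4) by (simp add: fgen_def)

lemma chi_hom: "chi n \<in> hom F F"
  unfolding chi_def by (rule F.free_lift_hom) (auto intro!: F.m_closed F.inv_closed)

lemma chi_gen:
  "i < 2 * n \<Longrightarrow> chi n (fgen n i) = (if Suc i < 2 * n then fgen n (Suc i)
     else inv\<^bsub>F\<^esub> (gprod F (map (\<lambda>k. fgen n (2 * k)) [0..<n])) \<otimes>\<^bsub>F\<^esub>
       gprod F (map (\<lambda>k. fgen n (2 * k + 1)) [0..<n]))"
  unfolding chi_def fgen_def[of n i]
  by (subst F.free_lift_gen) (auto intro!: F.m_closed F.inv_closed)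

lemma psi_images_closed:
  "\<forall>i\<in>{..<2 * n}. (if i = 0 then
       gprod F (map (\<lambda>k. fgen n (2 * k)) [0..<n] @
                map (\<lambda>k. inv\<^bsub>F\<^esub> (fgen n (2 * k + 1))) (rev [0..<n]))
     else fgen n (i - 1)) \<in> carrier F"
  by (auto intro!: F.gprod_closed F.inv_closed)

lemma psi_hom: "psi n \<in> hom F F"
  unfolding psi_def by (rule F.free_lift_hom[OF psi_images_closed])

lemma psi_gen_0:
  "psi n (fgen n 0) = gprod F (map (\<lambda>k. fgen n (2 * k)) [0..<n]) \<otimes>\<^bsub>F\<^esub>
     inv\<^bsub>F\<^esub> (gprod F (map (\<lambda>k. fgen n (2 * k + 1)) [0..<n]))"
proof -
  have "psi n (fgen n 0) = gprod F (map (\<lambda>k. fgen n (2 * k)) [0..<n] @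
      map (\<lambda>k. inv\<^bsub>F\<^esub> (fgen n (2 * k + 1))) (rev [0..<n]))"
    unfolding psi_def fgen_def[of n 0] using n_pos
    by (subst F.free_lift_gen[OF psi_images_closed]) auto
  also have "\<dots> = gprod F (map (\<lambda>k. fgen n (2 * k)) [0..<n]) \<otimes>\<^bsub>F\<^esub>
      gprod F (map (\<lambda>g. inv\<^bsub>F\<^esub> g) (rev (map (\<lambda>k. fgen n (2 * k + 1)) [0..<n])))"
    by (subst F.gprod_append) (auto intro!: F.inv_closed simp: rev_map comp_def)
  also have "gprod F (map (\<lambda>g. inv\<^bsub>F\<^esub> g) (rev (map (\<lambda>k. fgen n (2 * k + 1)) [0..<n])))
      = inv\<^bsub>F\<^esub> (gprod F (map (\<lambda>k. fgen n (2 * k + 1)) [0..<n]))"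
    by (rule F.gprod_rev_inv) auto
  finally show ?thesis .
qed

lemma psi_gen_Suc: "Suc i < 2 * n \<Longrightarrow> psi n (fgen n (Suc i)) = fgen n i"
  unfolding psi_def fgen_def[of n "Suc i"]
  by (subst F.free_lift_gen[OF psi_images_closed]) auto

section \<open>The sequence \<open>x_k\<close> and the products \<open>P_k\<close>\<close>

sublocale chi: group_hom F F "chi n"
  by unfold_locales (rule chi_hom)

sublocale psi: group_hom F F "psi n"
  by unfold_locales (rule psi_hom)

lemma chi_pow_hom: "(chi n ^^ k) \<in> hom F F"
proof (induction k)
  case 0
  show ?case by (simp add: hom_def id_def)
next
  case (Suc k)
  show ?case using hom_compose[OF Suc chi_hom] by (simp add: comp_def)
qed

sublocale chi_pow: group_hom F F "chi n ^^ k" for k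
  by unfold_locales (rule chi_pow_hom)

lemma free_seq_closed [simp]: "free_seq n k \<in> carrier F"
  unfolding free_seq_def using n_pos by (intro chi_pow.hom_closed) simp

lemma alt_prod_closed [simp]: "alt_prod n k \<in> carrier F"
  unfolding alt_prod_def by simp

lemma chi_free_seq: "chi n (free_seq n k) = free_seq n (Suc k)"
  by (simp add: free_seq_def)

lemma chi_pow_free_seq: "(chi n ^^ k) (free_seq n j) = free_seq n (j + k)"
  by (simp add: free_seq_def funpow_add add.commute[of j])

lemma chi_pow_alt_prod: "(chi n ^^ k) (alt_prod n j) = alt_prod n (j + k)"
  unfolding alt_prod_def
  by (subst chi_pow.hom_gprod)
     (auto simp: comp_def chi_pow_free_seq add_ac)

lemma chi_alt_prod: "chi n (alt_prod n j) = alt_prod n (Suc j)"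
  using chi_pow_alt_prod[of 1 j] by simp

lemma free_seq_eq_fgen: "k < 2 * n \<Longrightarrow> free_seq n k = fgen n k"
  by (induction k) (simp_all add: free_seq_def chi_gen)

lemma alt_prod_0: "alt_prod n 0 = gprod F (map (\<lambda>k. fgen n (2 * k)) [0..<n])"
  and alt_prod_1: "alt_prod n 1 = gprod F (map (\<lambda>k. fgen n (2 * k + 1)) [0..<n])"
  unfolding alt_prod_def by (auto intro!: arg_cong[where f = "gprod F"] simp: free_seq_eq_fgen)

lemma free_seq_2n: "free_seq n (2 * n) = inv\<^bsub>F\<^esub> alt_prod n 0 \<otimes>\<^bsub>F\<^esub> alt_prod n 1"
proof -
  have "free_seq n (2 * n) = chi n (fgen n (2 * n - 1))"
    using chi_free_seq[of "2 * n - 1"] n_pos by (simp add: free_seq_eq_fgen)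
  then show ?thesis
    using n_pos unfolding alt_prod_0 alt_prod_1 by (simp add: chi_gen)
qed

text \<open>For \<open>k = 0\<close> this is the value of \<open>chi\<close> at the last generator,
  rearranged; applying \<open>chi ^^ k\<close> moves it to every index.\<close>

lemma alt_prod_mult_free_seq: "alt_prod n k \<otimes>\<^bsub>F\<^esub> free_seq n (k + 2 * n) = alt_prod n (Suc k)"
proof -
  have "alt_prod n 0 \<otimes>\<^bsub>F\<^esub> free_seq n (2 * n) = alt_prod n 1"
    by (simp add: free_seq_2n)
  then have "(chi n ^^ k) (alt_prod n 0 \<otimes>\<^bsub>F\<^esub> free_seq n (2 * n)) = (chi n ^^ k) (alt_prod n 1)"
    by (rule arg_cong)
  then show ?thesis
    by (simp add: chi_pow_alt_prod chi_pow_free_seq add.commute)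
qed

text \<open>The product of the \<open>n + 1\<close> terms \<open>x_k, x_(k+2), ..., x_(k+2n)\<close>
  is split once after its first factor and once before its last.\<close>

lemma free_seq_mult_alt_prod: "free_seq n k \<otimes>\<^bsub>F\<^esub> alt_prod n (k + 2) = alt_prod n (Suc k)"
proof -
  have "free_seq n k \<otimes>\<^bsub>F\<^esub> alt_prod n (k + 2) = gprod F (map (\<lambda>j. free_seq n (k + 2 * j)) [0..<Suc n])"
    unfolding alt_prod_def upt_conv_Cons[OF zero_less_Suc] map_Suc_upt[symmetric]
    by (simp add: comp_def)
  also have "\<dots> = alt_prod n k \<otimes>\<^bsub>F\<^esub> free_seq n (k + 2 * n)"
    unfolding alt_prod_def by (simp add: F.gprod_append image_subset_iff)
  finally show ?thesis by (simp add: alt_prod_mult_free_seq)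
qed

section \<open>\<open>psi\<close> and \<open>chi\<close> are mutually inverse\<close>

lemma psi_free_seq_Suc: "Suc k < 2 * n \<Longrightarrow> psi n (free_seq n (Suc k)) = free_seq n k"
  by (simp add: free_seq_eq_fgen psi_gen_Suc)

text \<open>This settles the last generator, the only one for which \<open>psi\<close> does not
  obviously undo \<open>chi\<close>. All factors of \<open>P_1\<close> are shifted, so
  \<open>psi P_1 = P_0\<close>. All factors of \<open>P_0\<close> but the first are shifted, so
  \<open>psi P_0 = P_0 P_1^-1 Q\<close>, where \<open>Q\<close> is \<open>P_1\<close> without its
  last factor; this equals \<open>P_0 x_(2n-1)^-1\<close>.\<close>

lemma psi_free_seq_2n: "psi n (free_seq n (2 * n)) = free_seq n (2 * n - 1)"
proof -
  obtain m where m: "n = Suc m" using n_pos by (cases n) auto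
  \<comment> \<open>\<open>P_0\<close> is to be split at its first factor, where \<open>psi\<close>
    is not a shift, and \<open>P_1\<close> at its last factor.\<close>
  have upt: "[0..<n] = 0 # map Suc [0..<m]"
    by (simp add: m upt_conv_Cons map_Suc_upt del: upt_Suc)
  have upt': "[0..<n] = [0..<m] @ [m]" and last: "2 * n - 1 = 1 + 2 * m"
    by (simp_all add: m)
  have e1: "psi n (alt_prod n 1) = alt_prod n 0"
    unfolding alt_prod_def
    by (subst psi.hom_gprod) (auto intro!: arg_cong[where f = "gprod F"] simp: psi_free_seq_Suc)
  let ?p = "gprod F (map (\<lambda>j. free_seq n (1 + 2 * j)) [0..<m])"
  have "alt_prod n 0 = free_seq n 0 \<otimes>\<^bsub>F\<^esub> gprod F (map (\<lambda>j. free_seq n (2 + 2 * j)) [0..<m])"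
    unfolding alt_prod_def upt by (simp add: comp_def)
  then have "psi n (alt_prod n 0) = psi n (free_seq n 0) \<otimes>\<^bsub>F\<^esub>
      gprod F (map (\<lambda>j. psi n (free_seq n (2 + 2 * j))) [0..<m])"
    by (simp add: psi.hom_gprod comp_def image_subset_iff)
  also have "map (\<lambda>j. psi n (free_seq n (2 + 2 * j))) [0..<m] = map (\<lambda>j. free_seq n (1 + 2 * j)) [0..<m]"
    using psi_free_seq_Suc[of "Suc (2 * j)" for j] m by simp
  also have "psi n (free_seq n 0) = alt_prod n 0 \<otimes>\<^bsub>F\<^esub> inv\<^bsub>F\<^esub> alt_prod n 1"
    unfolding alt_prod_0 alt_prod_1 using n_pos by (simp add: free_seq_eq_fgen psi_gen_0)
  also have "alt_prod n 1 = ?p \<otimes>\<^bsub>F\<^esub> free_seq n (2 * n - 1)"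
    unfolding alt_prod_def upt' last by (simp add: F.gprod_append image_subset_iff)
  finally have e0: "psi n (alt_prod n 0) = alt_prod n 0 \<otimes>\<^bsub>F\<^esub> inv\<^bsub>F\<^esub> free_seq n (2 * n - 1)"
    by (simp add: F.inv_mult_group F.m_assoc)
  show ?thesis
    unfolding free_seq_2n using e0 e1 by (simp add: F.inv_mult_group F.m_assoc)
qed

lemma psi_chi [simp]:
  assumes "c \<in> carrier F"
  shows "psi n (chi n c) = c"
proof -
  have "(psi n \<circ> chi n) c = id c"
  proof (rule free_hom_eqI[where h = "psi n \<circ> chi n" and h' = id, OF F.is_group])
    show "psi n \<circ> chi n \<in> hom F F" by (rule hom_compose[OF chi_hom psi_hom])
    show "id \<in> hom F F" by (simp add: hom_def id_def)
    fix i assume i: "i < 2 * n"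
    show "(psi n \<circ> chi n) (fgen n i) = id (fgen n i)"
    proof (cases "Suc i < 2 * n")
      case True
      then show ?thesis using i by (simp add: chi_gen psi_gen_Suc)
    next
      case False
      then have "2 * n = Suc i" using i by simp
      then show ?thesis
        using psi_free_seq_2n i by (simp add: chi_free_seq[symmetric] free_seq_eq_fgen)
    qed
  qed (use assms in simp)
  then show ?thesis by simp
qed

lemma chi_psi [simp]:
  assumes "c \<in> carrier F"
  shows "chi n (psi n c) = c"
proof -
  have "(chi n \<circ> psi n) c = id c"
  proof (rule free_hom_eqI[where h = "chi n \<circ> psi n" and h' = id, OF F.is_group])
    show "chi n \<circ> psi n \<in> hom F F" by (rule hom_compose[OF psi_hom chi_hom])
    show "id \<in> hom F F" by (simp add: hom_def id_def)
    fix i assume i: "i < 2 * n"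
    show "(chi n \<circ> psi n) (fgen n i) = id (fgen n i)"
    proof (cases i)
      \<comment> \<open>The only generator that \<open>psi\<close> does not shift:
        \<open>chi\<close> sends its image to \<open>P_1 P_2^-1\<close>, and
        \<open>P_1 = x_0 P_2\<close>.\<close>
      case 0
      have "psi n (fgen n 0) = alt_prod n 0 \<otimes>\<^bsub>F\<^esub> inv\<^bsub>F\<^esub> alt_prod n 1"
        unfolding alt_prod_0 alt_prod_1 by (rule psi_gen_0)
      then have "chi n (psi n (fgen n 0)) = alt_prod n 1 \<otimes>\<^bsub>F\<^esub> inv\<^bsub>F\<^esub> alt_prod n 2"
        using chi_alt_prod[of 0] chi_alt_prod[of 1, unfolded Suc_1] by simp
      also have "alt_prod n 1 = fgen n 0 \<otimes>\<^bsub>F\<^esub> alt_prod n 2"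
        using free_seq_mult_alt_prod[of 0] n_pos by (simp add: free_seq_eq_fgen numeral_2_eq_2[symmetric])
      finally show ?thesis
        using 0 i by (simp add: F.m_assoc)
    next
      case (Suc j)
      then show ?thesis using i by (simp add: psi_gen_Suc chi_gen)
    qed
  qed (use assms in simp)
  then show ?thesis by simp
qed

text \<open>\<open>psi_inv\<close> chooses preimages in the carrier; \<open>chi\<close> being a left
  inverse makes \<open>psi\<close> injective there, so the choice is forced.\<close>

lemma psi_inv_eq_chi:
  assumes "c \<in> carrier F"
  shows "psi_inv n c = chi n c"
  unfolding psi_inv_def
proof (rule inv_into_f_eq)
  show "inj_on (psi n) (carrier F)"
    by (rule inj_on_inverseI[where g = "chi n"]) simp
qed (use assms in simp_all)

lemma psi_inv_pow:
  assumes "c \<in> carrier F"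
  shows "(psi_inv n ^^ k) c = (chi n ^^ k) c"
proof (induction k)
  case (Suc k)
  then show ?case by (simp add: psi_inv_eq_chi[OF chi_pow.hom_closed[OF assms]])
qed simp

lemma chi_inj: "c \<in> carrier F \<Longrightarrow> d \<in> carrier F \<Longrightarrow> chi n c = chi n d \<Longrightarrow> c = d"
  by (metis psi_chi)

lemma chi_pow_inj: "c \<in> carrier F \<Longrightarrow> d \<in> carrier F \<Longrightarrow> (chi n ^^ k) c = (chi n ^^ k) d \<Longrightarrow> c = d"
proof (induction k)
  case (Suc k)
  then show ?case
    using chi_inj[of "(chi n ^^ k) c" "(chi n ^^ k) d"] by (simp add: chi_pow.hom_closed)
qed simp

section \<open>The power of the automorphism that is inner\<close>

text \<open>Telescoping of \<open>P_j x_(j+2n) = P_(j+1)\<close>.\<close>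

lemma alt_prod_mult_prod:
  "alt_prod n k \<otimes>\<^bsub>F\<^esub> gprod F (map (\<lambda>j. free_seq n (k + 2 * n + j)) [0..<m]) = alt_prod n (k + m)"
proof (induction m)
  case 0
  show ?case by simp
next
  case (Suc m)
  let ?g = "gprod F (map (\<lambda>j. free_seq n (k + 2 * n + j)) [0..<m])"
  have "gprod F (map (\<lambda>j. free_seq n (k + 2 * n + j)) [0..<Suc m]) = ?g \<otimes>\<^bsub>F\<^esub> free_seq n (k + m + 2 * n)"
    by (simp add: F.gprod_append image_subset_iff add_ac)
  then show ?case
    using Suc alt_prod_mult_free_seq[of "k + m"] by (simp flip: F.m_assoc)
qed

lemma Sigma_closed [simp]: "Sigma_elt n \<in> carrier F"
  unfolding Sigma_elt_def by (auto intro!: F.m_closed F.inv_closed)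

text \<open>The factor \<open>x_(k+2n)\<close> moves from one product to the other: \<open>P_(k+1)
  P_(k+2n+2) = P_k x_(k+2n) P_(k+2n+2) = P_k P_(k+2n+1)\<close>.\<close>

lemma chi_alt_prod_pair:
  "chi n (alt_prod n k \<otimes>\<^bsub>F\<^esub> alt_prod n (Suc (k + 2 * n))) = alt_prod n k \<otimes>\<^bsub>F\<^esub> alt_prod n (Suc (k + 2 * n))"
proof -
  have "alt_prod n (Suc k) = alt_prod n k \<otimes>\<^bsub>F\<^esub> free_seq n (k + 2 * n)"
    by (simp add: alt_prod_mult_free_seq)
  moreover have "free_seq n (k + 2 * n) \<otimes>\<^bsub>F\<^esub> alt_prod n (Suc (Suc (k + 2 * n))) = alt_prod n (Suc (k + 2 * n))"
    using free_seq_mult_alt_prod[of "k + 2 * n"] by simp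
  ultimately show ?thesis
    by (simp add: chi_alt_prod F.m_assoc)
qed

text \<open>The identity is checked after applying \<open>chi ^^ (2 * n)\<close>, which is injective
  and fixes \<open>?P\<close>. The definition of \<open>Sigma_elt\<close> becomes
  \<open>P_(2n) T'^-1 P_(2n+1)\<close>, where \<open>T'\<close> is the image of the product
  \<open>?T\<close> of all generators, and telescoping gives \<open>P_(2n) = P_0 T'\<close>.\<close>

lemma Sigma_eq: "Sigma_elt n = alt_prod n 0 \<otimes>\<^bsub>F\<^esub> alt_prod n (Suc (2 * n))" (is "_ = ?P")
proof -
  have P: "(chi n ^^ k) ?P = ?P" for k
    using chi_alt_prod_pair[of 0] by (induction k) simp_all
  have T: "gprod F (map (fgen n) [0..<2 * n]) = gprod F (map (free_seq n) [0..<2 * n])"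
    by (rule arg_cong[where f = "gprod F"]) (simp add: free_seq_eq_fgen)
  let ?T = "gprod F (map (free_seq n) [0..<2 * n])"
  have "(chi n ^^ (2 * n)) ?T = gprod F (map (\<lambda>j. free_seq n (0 + 2 * n + j)) [0..<2 * n])"
    by (subst chi_pow.hom_gprod) (auto simp: comp_def chi_pow_free_seq add.commute)
  also have "alt_prod n 0 \<otimes>\<^bsub>F\<^esub> \<dots> = alt_prod n (2 * n)"
    using alt_prod_mult_prod[of 0 "2 * n"] by simp
  finally have T': "alt_prod n (2 * n) = alt_prod n 0 \<otimes>\<^bsub>F\<^esub> (chi n ^^ (2 * n)) ?T" by simp
  have [simp]: "?T \<in> carrier F" by simp
  have "(chi n ^^ (2 * n)) (Sigma_elt n) =
      alt_prod n (2 * n) \<otimes>\<^bsub>F\<^esub> inv\<^bsub>F\<^esub> ((chi n ^^ (2 * n)) ?T) \<otimes>\<^bsub>F\<^esub> alt_prod n (Suc (2 * n))"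
    unfolding Sigma_elt_def alt_prod_0[symmetric] alt_prod_1[symmetric] T
    by (simp add: chi_pow_alt_prod)
  also have "\<dots> = ?P"
    unfolding T' by (simp add: F.m_assoc)
  finally have "(chi n ^^ (2 * n)) (Sigma_elt n) = (chi n ^^ (2 * n)) ?P"
    by (simp add: P)
  then show ?thesis
    by (rule chi_pow_inj[rotated 2]) simp_all
qed

lemma chi_Sigma: "chi n (Sigma_elt n) = Sigma_elt n"
  unfolding Sigma_eq using chi_alt_prod_pair[of 0] by simp

lemma chi_pow_Sigma: "(chi n ^^ k) (Sigma_elt n) = Sigma_elt n"
  by (induction k) (simp_all add: chi_Sigma)

lemma psi_Sigma: "psi n (Sigma_elt n) = Sigma_elt n"
  using psi_chi[OF Sigma_closed] by (simp add: chi_Sigma)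

text \<open>Combines \<open>P_(k+1) x_(k+2n+1) = P_(k+2)\<close> with
  \<open>x_k P_(k+2) = P_(k+1)\<close>. A shift by \<open>2n + 1\<close> inverts up to conjugacy, so
  a second such shift leaves only a conjugation.\<close>

lemma free_seq_conj:
  "free_seq n (Suc (k + 2 * n)) = inv\<^bsub>F\<^esub> alt_prod n (Suc k) \<otimes>\<^bsub>F\<^esub> inv\<^bsub>F\<^esub> free_seq n k \<otimes>\<^bsub>F\<^esub> alt_prod n (Suc k)"
proof -
  have "alt_prod n (Suc k) \<otimes>\<^bsub>F\<^esub> free_seq n (Suc (k + 2 * n)) = alt_prod n (k + 2)"
    using alt_prod_mult_free_seq[of "Suc k"] by simp
  moreover have "alt_prod n (k + 2) = inv\<^bsub>F\<^esub> free_seq n k \<otimes>\<^bsub>F\<^esub> alt_prod n (Suc k)"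
    unfolding free_seq_mult_alt_prod[symmetric] by simp
  ultimately show ?thesis
    by (metis F.inv_cancel_left(1) F.inv_closed F.m_assoc alt_prod_closed free_seq_closed)
qed

text \<open>For \<open>x_0\<close> two uses of \<open>free_seq_conj\<close> suffice. The other
  generators are images of \<open>x_0\<close> under \<open>chi ^^ i\<close>, which commutes with the
  power in question and fixes \<open>Sigma_elt n\<close>.\<close>

lemma chi_pow_period:
  assumes "c \<in> carrier F"
  shows "(chi n ^^ (4 * n + 2)) c = inv\<^bsub>F\<^esub> Sigma_elt n \<otimes>\<^bsub>F\<^esub> c \<otimes>\<^bsub>F\<^esub> Sigma_elt n"
proof -
  let ?S = "Sigma_elt n" and ?c = "\<lambda>c. inv\<^bsub>F\<^esub> Sigma_elt n \<otimes>\<^bsub>F\<^esub> c \<otimes>\<^bsub>F\<^esub> Sigma_elt n"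
  \<comment> \<open>The form of \<open>?S\<close> shifted by one index is needed, since the
    conjugating elements are \<open>P_1\<close> and \<open>P_(2n+2)\<close>.\<close>
  have S: "?S = alt_prod n 1 \<otimes>\<^bsub>F\<^esub> alt_prod n (2 * n + 2)"
    using chi_Sigma unfolding Sigma_eq by (simp add: chi_alt_prod)
  have e: "4 * n + 2 = Suc (Suc (2 * n) + 2 * n)" "Suc (0 + 2 * n) = Suc (2 * n)" "Suc (Suc (2 * n)) = 2 * n + 2"
    by simp_all
  have "free_seq n (4 * n + 2) = ?c (free_seq n 0)"
    unfolding S e(1) free_seq_conj[of "Suc (2 * n)"] using free_seq_conj[of 0]
    by (simp add: F.inv_mult_group F.m_assoc)
  then have x0: "(chi n ^^ (4 * n + 2)) (fgen n 0) = ?c (fgen n 0)"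
    by (simp add: free_seq_def)
  show ?thesis
  proof (rule free_hom_eqI[OF F.is_group chi_pow_hom _ _ assms])
    show "?c \<in> hom F F"
      by (rule homI) (simp_all add: F.m_assoc)
    fix i assume "i < 2 * n"
    then have i: "fgen n i = (chi n ^^ i) (fgen n 0)"
      using free_seq_eq_fgen[of i] by (simp add: free_seq_def)
    have "(chi n ^^ (4 * n + 2)) (fgen n i) = (chi n ^^ i) ((chi n ^^ (4 * n + 2)) (fgen n 0))"
      unfolding i by (rule funpow_swap)
    also have "\<dots> = ?c (fgen n i)"
      unfolding x0 using i n_pos by (simp add: chi_pow_Sigma)
    finally show "(chi n ^^ (4 * n + 2)) (fgen n i) = ?c (fgen n i)" .
  qed
qed

end

section \<open>General linear groups and block matrices\<close>

lemma adjoin_zero [simp]: "0 \<in> adjoin A"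
  and adjoin_one [simp]: "1 \<in> adjoin A"
  and adjoin_incl: "a \<in> A \<Longrightarrow> a \<in> adjoin A"
  and adjoin_add: "x \<in> adjoin A \<Longrightarrow> y \<in> adjoin A \<Longrightarrow> x + y \<in> adjoin A"
  and adjoin_mult: "x \<in> adjoin A \<Longrightarrow> y \<in> adjoin A \<Longrightarrow> x * y \<in> adjoin A"
  and adjoin_uminus: "x \<in> adjoin A \<Longrightarrow> - x \<in> adjoin A"
  using ring.zero_in_generate[OF class_ring.ring_axioms, of A] generate_ring.one[of "class_ring :: complex ring" A]
    generate_ring.incl[of a A "class_ring :: complex ring"]
    generate_ring.eng_add[of x "class_ring :: complex ring" A y]
    generate_ring.eng_mult[of x "class_ring :: complex ring" A y]
    generate_ring.a_inv[of x "class_ring :: complex ring" A]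
  by (simp_all add: adjoin_def class_ring_simps)

lemma adjoin_mono: "A \<subseteq> B \<Longrightarrow> adjoin A \<subseteq> adjoin B"
  unfolding adjoin_def by (rule ring.mono_generate_ring[OF class_ring.ring_axioms]) simp_all

lemma adjoin_sum: "(\<And>i. i \<in> I \<Longrightarrow> f i \<in> adjoin A) \<Longrightarrow> sum f I \<in> adjoin A"
  by (induction I rule: infinite_finite_induct) (auto intro: adjoin_add)

lemma elements_mat_subset_iff:
  "M \<in> carrier_mat m m \<Longrightarrow> elements_mat M \<subseteq> R \<longleftrightarrow> (\<forall>i<m. \<forall>j<m. M $$ (i, j) \<in> R)"
  by (force simp: elements_mat_def)

lemma GL_mult [simp]: "monoid.mult (GL m R) = (*)"
  and GL_one [simp]: "\<one>\<^bsub>GL m R\<^esub> = 1\<^sub>m m"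
  by (simp_all add: GL_def units_of_def ring_mat_simps)

lemma GL_carrier_iff:
  "M \<in> carrier (GL m R) \<longleftrightarrow> M \<in> carrier_mat m m \<and> elements_mat M \<subseteq> R \<and>
    (\<exists>M'\<in>carrier_mat m m. elements_mat M' \<subseteq> R \<and> M * M' = 1\<^sub>m m \<and> M' * M = 1\<^sub>m m)"
  by (auto simp: GL_def units_of_def Units_def ring_mat_simps)

lemma GL_carrier_mat: "M \<in> carrier (GL m R) \<Longrightarrow> M \<in> carrier_mat m m"
  by (simp add: GL_carrier_iff)

lemma GL_mono: "R \<subseteq> R' \<Longrightarrow> carrier (GL m R) \<subseteq> carrier (GL m R')"
  unfolding GL_carrier_iff subset_iff by blast

lemma group_GL: "group (GL m (adjoin A))"
  unfolding GL_def
proof (rule monoid.units_group, rule monoidI)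
  let ?M = "ring_mat TYPE(complex) m () \<lparr>carrier := {M \<in> carrier_mat m m. elements_mat M \<subseteq> adjoin A}\<rparr>"
  show "\<one>\<^bsub>?M\<^esub> \<in> carrier ?M"
    by (simp add: ring_mat_simps elements_mat_subset_iff[OF one_carrier_mat])
  fix M M' assume "M \<in> carrier ?M" "M' \<in> carrier ?M"
  then have M: "M \<in> carrier_mat m m" "M' \<in> carrier_mat m m"
    and e: "\<And>i j. i < m \<Longrightarrow> j < m \<Longrightarrow> M $$ (i, j) \<in> adjoin A \<and> M' $$ (i, j) \<in> adjoin A"
    by (auto simp: elements_mat_subset_iff)
  have "elements_mat (M * M') \<subseteq> adjoin A"
    unfolding elements_mat_subset_iff[OF mult_carrier_mat[OF M]]
    using M e by (auto simp: scalar_prod_def intro!: adjoin_sum adjoin_mult)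
  then show "M \<otimes>\<^bsub>?M\<^esub> M' \<in> carrier ?M"
    using M by (simp add: ring_mat_simps)
qed (auto simp: ring_mat_simps)

section \<open>Cyclic block shifts with 2 by 2 blocks\<close>

lemma index_mult_mat_2:
  assumes "A \<in> carrier_mat 2 2" "B \<in> carrier_mat 2 2" "i < 2" "j < 2"
  shows "(A * B) $$ (i, j) = A $$ (i, 0) * B $$ (0, j) + A $$ (i, 1) * B $$ (1, j)"
  using assms by (simp add: scalar_prod_def numeral_2_eq_2)

text \<open>A block monomial matrix whose pattern is the \<open>k\<close>-th power of the cyclic
  shift. The diagonal matrices (\<open>k = 0\<close>), both generator images (\<open>k = 1\<close>)
  and all products of these have this form, so that computations reduce to single blocks.\<close>

definition shift_mat :: "nat \<Rightarrow> nat \<Rightarrow> (nat \<Rightarrow> complex mat) \<Rightarrow> complex mat" where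
  "shift_mat N k d = block_mat N (\<lambda>i j. if j = (i + k) mod N then d i else 0\<^sub>m 2 2)"

lemma shift_mat_carrier [simp]: "shift_mat N k d \<in> carrier_mat (2 * N) (2 * N)"
  by (simp add: shift_mat_def block_mat_def)

lemma shift_mat_index:
  "i < 2 * N \<Longrightarrow> j < 2 * N \<Longrightarrow> shift_mat N k d $$ (i, j) =
    (if j div 2 = (i div 2 + k) mod N then d (i div 2) $$ (i mod 2, j mod 2) else 0)"
  by (simp add: shift_mat_def block_mat_def)

lemma shift_mat_cong:
  assumes "k mod N = k' mod N" "\<And>i. i < N \<Longrightarrow> d i = d' i"
  shows "shift_mat N k d = shift_mat N k' d'"
proof (rule eq_matI)
  fix i j assume "i < dim_row (shift_mat N k' d')" "j < dim_col (shift_mat N k' d')"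
  then have "i < 2 * N" "j < 2 * N" by (simp_all add: shift_mat_def block_mat_def)
  then show "shift_mat N k d $$ (i, j) = shift_mat N k' d' $$ (i, j)"
    using assms(2)[of "i div 2"] mod_add_cong[OF HOL.refl assms(1), of "i div 2"]
    by (simp add: shift_mat_index)
qed (simp_all add: shift_mat_def block_mat_def)

lemma shift_mat_one: "shift_mat N 0 (\<lambda>_. 1\<^sub>m 2) = 1\<^sub>m (2 * N)"
proof (rule eq_matI)
  fix i j assume "i < dim_row (1\<^sub>m (2 * N) :: complex mat)" "j < dim_col (1\<^sub>m (2 * N) :: complex mat)"
  then have ij: "i < 2 * N" "j < 2 * N" by simp_all
  moreover have "i = j \<longleftrightarrow> i div 2 = j div 2 \<and> i mod 2 = j mod 2"
    by (metis div_mult_mod_eq)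
  ultimately show "shift_mat N 0 (\<lambda>_. 1\<^sub>m 2) $$ (i, j) = 1\<^sub>m (2 * N) $$ (i, j)"
    by (auto simp: shift_mat_index)
qed (simp_all add: shift_mat_def block_mat_def)

lemma shift_mat_mult:
  assumes "\<And>i. i < N \<Longrightarrow> d i \<in> carrier_mat 2 2" "\<And>i. i < N \<Longrightarrow> e i \<in> carrier_mat 2 2"
  shows "shift_mat N k d * shift_mat N l e = shift_mat N (k + l) (\<lambda>i. d i * e ((i + k) mod N))"
    (is "?A * ?B = ?C")
proof (rule eq_matI)
  fix i j assume "i < dim_row ?C" "j < dim_col ?C"
  then have ij: "i < 2 * N" "j < 2 * N" by (simp_all add: shift_mat_def block_mat_def)
  define p where "p = (i div 2 + k) mod N"
  have N: "0 < N" and p: "p < N" and iN: "i div 2 < N" using ij by (simp_all add: p_def)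
  have ppl: "(p + l) mod N = (i div 2 + (k + l)) mod N"
    by (simp add: p_def mod_simps add.assoc)
  have "(?A * ?B) $$ (i, j) = (\<Sum>q = 0..<2 * N. ?A $$ (i, q) * ?B $$ (q, j))"
    using ij by (simp add: scalar_prod_def shift_mat_def block_mat_def)
  \<comment> \<open>Row \<open>i\<close> of \<open>?A\<close> is supported on the two columns of
    block \<open>p\<close>.\<close>
  also have "\<dots> = (\<Sum>q\<in>{2 * p, 2 * p + 1}. ?A $$ (i, q) * ?B $$ (q, j))"
  proof (rule sum.mono_neutral_right)
    show "\<forall>q\<in>{0..<2 * N} - {2 * p, 2 * p + 1}. ?A $$ (i, q) * ?B $$ (q, j) = 0"
    proof
      fix q assume q: "q \<in> {0..<2 * N} - {2 * p, 2 * p + 1}"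
      then have "q div 2 \<noteq> p" by auto
      then show "?A $$ (i, q) * ?B $$ (q, j) = 0"
        using q ij by (simp add: shift_mat_index flip: p_def)
    qed
  qed (use p in auto)
  also have "\<dots> = ?C $$ (i, j)"
    using ij p N index_mult_mat_2[OF assms(1)[OF iN] assms(2)[OF p], of "i mod 2" "j mod 2"]
    by (simp add: shift_mat_index ppl flip: p_def)
  finally show "(?A * ?B) $$ (i, j) = ?C $$ (i, j)" .
qed (simp_all add: shift_mat_def block_mat_def)

text \<open>Comparing block (0, 0) is enough: it vanishes unless \<open>k mod N = 0\<close>, and
  then it is \<open>d 0\<close>.\<close>

lemma shift_mat_eq_oneD:
  assumes "shift_mat N k d = 1\<^sub>m (2 * N)" "0 < N" "d 0 \<in> carrier_mat 2 2"
  shows "k mod N = 0" "d 0 = 1\<^sub>m 2"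
proof -
  have e: "(if 0 = k mod N then d 0 $$ (r, c) else 0) = (1\<^sub>m 2 :: complex mat) $$ (r, c)"
    if "r < 2" "c < 2" for r c
  proof -
    have "shift_mat N k d $$ (r, c) = 1\<^sub>m (2 * N) $$ (r, c)" by (simp add: assms(1))
    moreover have "r < 2 * N" "c < 2 * N" using that assms(2) by auto
    moreover have "r div 2 = 0" "c div 2 = 0" "r mod 2 = r" "c mod 2 = c" using that by simp_all
    ultimately show ?thesis using that by (simp add: shift_mat_index split: if_splits)
  qed
  show *: "k mod N = 0" using e[of 0 0] by (auto split: if_splits)
  show "d 0 = 1\<^sub>m 2"
    by (rule eq_matI) (use e * assms(3) in \<open>auto simp: carrier_matD\<close>)
qed

lemma shift_mat_elements:
  assumes "\<And>i. i < N \<Longrightarrow> d i \<in> carrier_mat 2 2" "\<And>i. i < N \<Longrightarrow> elements_mat (d i) \<subseteq> adjoin A"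
  shows "elements_mat (shift_mat N k d) \<subseteq> adjoin A"
proof -
  have "d i $$ (r, c) \<in> adjoin A" if "i < N" "r < 2" "c < 2" for i r c
    using assms(2)[OF that(1)] that unfolding elements_mat_subset_iff[OF assms(1)[OF that(1)]] by blast
  then show ?thesis
    by (simp add: elements_mat_subset_iff[OF shift_mat_carrier] shift_mat_index)
qed

text \<open>The inverse is the shift by \<open>N - k\<close> with inverted and re-indexed blocks;
  \<open>k \<le> N\<close> makes the two shifts add up to \<open>N\<close>, that is, to the trivial
  shift.\<close>

lemma shift_mat_GL:
  assumes d: "\<And>i. i < N \<Longrightarrow> d i \<in> carrier (GL 2 (adjoin A))" and k: "k \<le> N"
  shows "shift_mat N k d \<in> carrier (GL (2 * N) (adjoin A))"
proof -
  interpret G: group "GL 2 (adjoin A)" by (rule group_GL)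
  define e where "e = (\<lambda>i. inv\<^bsub>GL 2 (adjoin A)\<^esub> (d ((i + (N - k)) mod N)))"
  have dc: "d i \<in> carrier_mat 2 2" "elements_mat (d i) \<subseteq> adjoin A" if "i < N" for i
    using d[OF that] by (simp_all add: GL_carrier_iff)
  have "e i \<in> carrier (GL 2 (adjoin A))" if "i < N" for i
    unfolding e_def using that by (intro G.inv_closed d) auto
  then have ec: "e i \<in> carrier_mat 2 2" "elements_mat (e i) \<subseteq> adjoin A" if "i < N" for i
    using that by (simp_all add: GL_carrier_iff)
  have "shift_mat N k d * shift_mat N (N - k) e =
      shift_mat N (k + (N - k)) (\<lambda>i. d i * e ((i + k) mod N))"
    by (rule shift_mat_mult) (simp_all add: dc ec)
  also have "\<dots> = shift_mat N 0 (\<lambda>_. 1\<^sub>m 2)"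
  proof (rule shift_mat_cong)
    fix i assume i: "i < N"
    have "((i + k) mod N + (N - k)) mod N = i"
      using i k by (simp only: mod_add_left_eq add.assoc le_add_diff_inverse mod_add_self2 mod_less)
    then show "d i * e ((i + k) mod N) = 1\<^sub>m 2"
      using G.r_inv[OF d[OF i]] by (simp add: e_def)
  qed (use k in simp)
  finally have de: "shift_mat N k d * shift_mat N (N - k) e = 1\<^sub>m (2 * N)"
    by (simp add: shift_mat_one)
  have "shift_mat N (N - k) e * shift_mat N k d =
      shift_mat N (N - k + k) (\<lambda>i. e i * d ((i + (N - k)) mod N))"
    by (rule shift_mat_mult) (simp_all add: dc ec)
  also have "\<dots> = shift_mat N 0 (\<lambda>_. 1\<^sub>m 2)"
  proof (rule shift_mat_cong)
    fix i assume i: "i < N"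
    show "e i * d ((i + (N - k)) mod N) = 1\<^sub>m 2"
      using G.l_inv[OF d[of "(i + (N - k)) mod N"]] i by (simp add: e_def)
  qed (use k in simp)
  finally have ed: "shift_mat N (N - k) e * shift_mat N k d = 1\<^sub>m (2 * N)"
    by (simp add: shift_mat_one)
  have "elements_mat (shift_mat N k d) \<subseteq> adjoin A"
    by (rule shift_mat_elements) (fact dc)+
  moreover have "elements_mat (shift_mat N (N - k) e) \<subseteq> adjoin A"
    by (rule shift_mat_elements) (fact ec)+
  ultimately show ?thesis
    unfolding GL_carrier_iff using de ed
    by (intro conjI bexI[of _ "shift_mat N (N - k) e"] shift_mat_carrier)
qed

section \<open>The two-dimensional representation of the free group\<close>

definition upper :: "complex \<Rightarrow> complex mat" where
  "upper t = mat_of_rows_list 2 [[1, t], [0, 1]]"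

definition lower :: "complex \<Rightarrow> complex mat" where
  "lower t = mat_of_rows_list 2 [[1, 0], [t, 1]]"

lemma upper_index [simp]:
  "upper t $$ (0, 0) = 1" "upper t $$ (0, Suc 0) = t" "upper t $$ (Suc 0, 0) = 0" "upper t $$ (Suc 0, Suc 0) = 1"
  and lower_index [simp]:
  "lower t $$ (0, 0) = 1" "lower t $$ (0, Suc 0) = 0" "lower t $$ (Suc 0, 0) = t" "lower t $$ (Suc 0, Suc 0) = 1"
  by (simp_all add: upper_def lower_def mat_of_rows_list_def)

lemma upper_carrier [simp]: "upper t \<in> carrier_mat 2 2"
  and lower_carrier [simp]: "lower t \<in> carrier_mat 2 2"
  by (simp_all add: upper_def lower_def mat_of_rows_list_def numeral_2_eq_2)

lemma eq_mat_2I: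
  assumes "A \<in> carrier_mat 2 2" "B \<in> carrier_mat 2 2"
    and "A $$ (0, 0) = B $$ (0, 0)" "A $$ (0, 1) = B $$ (0, 1)" "A $$ (1, 0) = B $$ (1, 0)" "A $$ (1, 1) = B $$ (1, 1)"
  shows "A = B"
  by (rule eq_matI) (use assms in \<open>auto simp: less_2_cases_iff\<close>)

lemma upper_mult: "upper t * upper u = upper (t + u)"
  and lower_mult: "lower t * lower u = lower (t + u)"
  by (rule eq_mat_2I; simp add: index_mult_mat_2 mult_carrier_mat[of _ 2 2])+

lemma upper_0: "upper 0 = 1\<^sub>m 2"
  and lower_0: "lower 0 = 1\<^sub>m 2"
  by (rule eq_mat_2I; simp)+

lemma upper_elements: "t \<in> adjoin A \<Longrightarrow> elements_mat (upper t) \<subseteq> adjoin A"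
  and lower_elements: "t \<in> adjoin A \<Longrightarrow> elements_mat (lower t) \<subseteq> adjoin A"
  by (auto simp: elements_mat_subset_iff[OF upper_carrier] elements_mat_subset_iff[OF lower_carrier] less_2_cases_iff)

lemma upper_GL: "t \<in> adjoin A \<Longrightarrow> upper t \<in> carrier (GL 2 (adjoin A))"
  unfolding GL_carrier_iff
  by (intro conjI bexI[of _ "upper (- t)"] upper_elements adjoin_uminus) (simp_all add: upper_mult upper_0)

lemma lower_GL: "t \<in> adjoin A \<Longrightarrow> lower t \<in> carrier (GL 2 (adjoin A))"
  unfolding GL_carrier_iff
  by (intro conjI bexI[of _ "lower (- t)"] lower_elements adjoin_uminus) (simp_all add: lower_mult lower_0)

lemma inv_upper: "t \<in> adjoin A \<Longrightarrow> inv\<^bsub>GL 2 (adjoin A)\<^esub> upper t = upper (- t)"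
  by (rule group.inv_equality[OF group_GL]) (simp_all add: upper_GL adjoin_uminus upper_mult upper_0)

lemma inv_lower: "t \<in> adjoin A \<Longrightarrow> inv\<^bsub>GL 2 (adjoin A)\<^esub> lower t = lower (- t)"
  by (rule group.inv_equality[OF group_GL]) (simp_all add: lower_GL adjoin_uminus lower_mult lower_0)

lemma upper_pow: "upper t [^]\<^bsub>GL 2 (adjoin A)\<^esub> (k::nat) = upper (of_nat k * t)"
  by (induction k) (simp_all add: upper_0 upper_mult algebra_simps)

lemma adjoin_of_nat_mult: "t \<in> adjoin A \<Longrightarrow> of_nat k * t \<in> adjoin A"
  by (induction k) (simp_all add: algebra_simps adjoin_add)

lemma det_upper [simp]: "det (upper t) = 1"
proof -
  have "det (upper t) = prod_list (diag_mat (upper t))"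
    by (rule det_upper_triangular[of _ 2]) (auto simp: upper_triangular_def upper_def mat_of_rows_list_def less_Suc_eq)
  then show ?thesis
    using carrier_matD[OF upper_carrier[of t]] by (simp add: diag_mat_def numeral_2_eq_2)
qed

lemma det_lower [simp]: "det (lower t) = 1"
proof -
  have "det (lower t) = prod_list (diag_mat (lower t))"
    by (rule det_lower_triangular[of 2]) (auto simp: lower_def mat_of_rows_list_def less_Suc_eq numeral_2_eq_2)
  then show ?thesis
    using carrier_matD[OF lower_carrier[of t]] by (simp add: diag_mat_def numeral_2_eq_2)
qed

text \<open>The image of a letter as an explicit matrix: inverting a conjugate of
  \<open>lower lam\<close> only changes the sign of \<open>lam\<close>, so one formula serves
  generators and inverses.\<close>

definition sigma_letter :: "complex \<Rightarrow> complex \<Rightarrow> nat \<times> bool \<Rightarrow> complex mat" where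
  "sigma_letter lam mu p = upper (- (of_nat (fst p) * mu)) * lower (if snd p then lam else - lam) *
     upper (of_nat (fst p) * mu)"

lemma sigma_letter_carrier [simp]: "sigma_letter lam mu p \<in> carrier_mat 2 2"
  by (simp add: sigma_letter_def mult_carrier_mat[of _ 2 2])

lemma det_sigma_letter [simp]: "det (sigma_letter lam mu p) = 1"
  by (simp add: sigma_letter_def det_mult[of _ 2] mult_carrier_mat[of _ 2 2])

lemma sigma_letter_GL: "sigma_letter lam mu p \<in> carrier (GL 2 (adjoin {lam, mu}))"
proof -
  interpret G: group "GL 2 (adjoin {lam, mu})" by (rule group_GL)
  have "lam \<in> adjoin {lam, mu}" "mu \<in> adjoin {lam, mu}" by (simp_all add: adjoin_incl)
  then have "upper (- (of_nat (fst p) * mu)) \<otimes>\<^bsub>GL 2 (adjoin {lam, mu})\<^esub> lower (if snd p then lam else - lam)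
      \<otimes>\<^bsub>GL 2 (adjoin {lam, mu})\<^esub> upper (of_nat (fst p) * mu) \<in> carrier (GL 2 (adjoin {lam, mu}))"
    by (intro G.m_closed upper_GL lower_GL) (simp_all add: adjoin_uminus adjoin_of_nat_mult)
  then show ?thesis by (simp add: sigma_letter_def)
qed

lemma sigma_letter_inv:
  "inv\<^bsub>GL 2 (adjoin {lam, mu})\<^esub> sigma_letter lam mu (i, True) = sigma_letter lam mu (i, False)"
proof -
  interpret G: group "GL 2 (adjoin {lam, mu})" by (rule group_GL)
  have l: "lam \<in> adjoin {lam, mu}" and m: "mu \<in> adjoin {lam, mu}" by (simp_all add: adjoin_incl)
  let ?u = "of_nat i * mu"
  have u: "?u \<in> adjoin {lam, mu}" "- ?u \<in> adjoin {lam, mu}"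
    using m by (simp_all add: adjoin_uminus adjoin_of_nat_mult)
  have "sigma_letter lam mu (i, True) = upper (- ?u) \<otimes>\<^bsub>GL 2 (adjoin {lam, mu})\<^esub> lower lam
      \<otimes>\<^bsub>GL 2 (adjoin {lam, mu})\<^esub> upper ?u"
    by (simp add: sigma_letter_def)
  then have "inv\<^bsub>GL 2 (adjoin {lam, mu})\<^esub> sigma_letter lam mu (i, True) =
      upper (- ?u) * (lower (- lam) * upper ?u)"
    using u l G.m_closed by (simp add: G.inv_mult_group upper_GL lower_GL inv_upper inv_lower del: GL_mult)
      simp
  also have "\<dots> = sigma_letter lam mu (i, False)"
    by (simp add: sigma_letter_def assoc_mult_mat[of _ 2 2 _ 2 _ 2])
  finally show ?thesis .
qed

lemma sigma_eq: "sigma n lam mu = pres_lift (GL 2 (adjoin {lam, mu})) (\<lambda>i. sigma_letter lam mu (i, True))"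
proof -
  interpret G: group "GL 2 (adjoin {lam, mu})" by (rule group_GL)
  have m: "mu \<in> adjoin {lam, mu}" by (simp add: adjoin_incl)
  have "upper mu [^]\<^bsub>GL 2 (adjoin {lam, mu})\<^esub> (- int i) = upper (- (of_nat i * mu))" for i
    using m by (simp add: G.int_pow_neg_int upper_GL upper_pow inv_upper adjoin_of_nat_mult)
  then show ?thesis
    by (simp add: sigma_def Let_def sigma_letter_def int_pow_int upper_pow flip: upper_def lower_def)
qed

section \<open>Ping-pong on pairs of complex numbers\<close>

definition act :: "complex mat \<Rightarrow> complex \<times> complex \<Rightarrow> complex \<times> complex" where
  "act M v = (M $$ (0, 0) * fst v + M $$ (0, 1) * snd v, M $$ (1, 0) * fst v + M $$ (1, 1) * snd v)"

lemma act_mult: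
  "M \<in> carrier_mat 2 2 \<Longrightarrow> M' \<in> carrier_mat 2 2 \<Longrightarrow> act (M * M') v = act M (act M' v)"
  by (simp add: act_def index_mult_mat_2 algebra_simps del: index_mult_mat)

lemma act_one: "act (1\<^sub>m 2) v = v"
  by (simp add: act_def)

lemma act_upper: "act (upper t) v = (fst v + t * snd v, snd v)"
  and act_lower: "act (lower t) v = (fst v, t * fst v + snd v)"
  by (simp_all add: act_def)

lemma act_upper_upper: "act (upper t) (act (upper u) v) = act (upper (t + u)) v"
  and act_lower_lower: "act (lower t) (act (lower u) v) = act (lower (t + u)) v"
  by (simp_all add: act_upper act_lower algebra_simps)

lemma act_sigma_letter:
  "act (sigma_letter lam mu p) v = act (upper (- (of_nat (fst p) * mu)))
     (act (lower (if snd p then lam else - lam)) (act (upper (of_nat (fst p) * mu)) v))"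
  by (simp add: sigma_letter_def act_mult mult_carrier_mat[of _ 2 2])

lemma word_eval_sigma_letter:
  "word_eval (GL 2 (adjoin {lam, mu})) (\<lambda>i. sigma_letter lam mu (i, True)) w =
    foldr (\<lambda>p M. sigma_letter lam mu p * M) w (1\<^sub>m 2)"
proof (induction w)
  case (Cons p w)
  then show ?case
    by (cases p) (auto simp: word_eval_def sigma_letter_inv)
qed (simp add: word_eval_def)

lemma foldr_sigma_letter_carrier [simp]: "foldr (\<lambda>p M. sigma_letter lam mu p * M) w (1\<^sub>m 2) \<in> carrier_mat 2 2"
  by (induction w) (simp_all add: mult_carrier_mat[of _ 2 2])

definition reduced :: "'g word \<Rightarrow> bool" where
  "reduced w \<longleftrightarrow> successively (\<lambda>p q. fst p = fst q \<longrightarrow> snd p = snd q) w"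

text \<open>A letter put in front of a reduced word either keeps it reduced or cancels its first
  letter, and the remaining tail is again reduced.\<close>

lemma reduced_representative:
  assumes "w \<in> words S"
  obtains r where "(w, r) \<in> pres_rel S R" "reduced r"
proof -
  have "\<exists>r. (w, r) \<in> pres_rel S R \<and> reduced r"
    using assms
  proof (induction w rule: lists.induct)
    case Nil
    then show ?case using pres_rel.refl[of "[]" S R] by (auto simp: reduced_def)
  next
    case (Cons p w)
    then obtain r where r: "(w, r) \<in> pres_rel S R" "reduced r" by blast
    have "[p] \<in> words S" using Cons.hyps by simp
    then have pr: "(p # w, p # r) \<in> pres_rel S R"
      using pres_rel_append_left[OF r(1)] by fastforce
    show ?case
    proof (cases "reduced (p # r)")
      case True
      then show ?thesis using pr by blast
    next
      case False
      then obtain q r' where q: "r = q # r'" "fst p = fst q" "snd p \<noteq> snd q"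
        using r(2) by (cases r) (auto simp: reduced_def)
      obtain a b where p: "p = (a, b)" by (cases p)
      have "q = (a, \<not> b)" using q p by (cases q) auto
      moreover have "a \<in> S" "r' \<in> words S"
        using pres_rel_words[OF pr] p q by auto
      ultimately have "(p # r, r') \<in> pres_rel S R"
        using pres_rel.cancel[of "[]" S r' a b R] p q by simp
      moreover have "reduced r'"
        using r(2) q(1) by (cases r') (simp_all add: reduced_def)
      ultimately show ?thesis using pr pres_rel.trans by blast
    qed
  qed
  then show thesis using that by blast
qed

text \<open>The new second coordinate has modulus at least
  \<open>2 * cmod (fst v) - cmod (snd v)\<close>, which exceeds \<open>cmod (fst v)\<close>. The
  strict inequality assumed for \<open>v\<close> is what admits the boundary case
  \<open>cmod t = 2\<close>.\<close>

lemma act_lower_pingpong: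
  assumes "cmod (snd v) < cmod (fst v)" "2 \<le> cmod t"
  shows "cmod (fst (act (lower t) v)) < cmod (snd (act (lower t) v))"
proof -
  have "2 * cmod (fst v) \<le> cmod (t * fst v)"
    using assms by (simp add: norm_mult mult_right_mono)
  moreover have "cmod (t * fst v) - cmod (snd v) \<le> cmod (t * fst v + snd v)"
    using norm_diff_ineq by blast
  ultimately show ?thesis using assms by (simp add: act_lower)
qed

lemma act_upper_pingpong:
  assumes "cmod (fst v) < cmod (snd v)" "2 \<le> cmod t"
  shows "cmod (snd (act (upper t) v)) < cmod (fst (act (upper t) v))"
proof -
  have "2 * cmod (snd v) \<le> cmod (t * snd v)"
    using assms by (simp add: norm_mult mult_right_mono)
  moreover have "cmod (t * snd v) - cmod (fst v) \<le> cmod (fst v + t * snd v)"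
    using norm_diff_ineq[of "t * snd v" "fst v"] by (simp add: add.commute)
  ultimately show ?thesis using assms by (simp add: act_upper)
qed

lemma two_le_cmod_mult:
  assumes "2 \<le> cmod t" "1 \<le> cmod z"
  shows "2 \<le> cmod (z * t)"
  using mult_mono[OF assms(2,1)] by (simp add: norm_mult)

text \<open>Counting the power \<open>k\<close> in the conclusion lets the induction absorb repeated letters; the start
  vector \<open>(1, 0)\<close> is fixed by every \<open>upper t\<close>.\<close>

lemma reduced_word_pingpong:
  fixes lam mu :: complex
  assumes lam: "2 \<le> cmod lam" and mu: "2 \<le> cmod mu" and "reduced (p # w)"
  shows "\<exists>k v. 1 \<le> k \<and> cmod (snd v) < cmod (fst v) \<and>
    act (upper (of_nat (fst p) * mu)) (act (foldr (\<lambda>p M. sigma_letter lam mu p * M) (p # w) (1\<^sub>m 2)) (1, 0)) =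
    act (lower (of_nat k * (if snd p then lam else - lam))) v"
  using assms(3)
proof (induction w arbitrary: p)
  case Nil
  have "act (upper (of_nat (fst p) * mu)) (act (foldr (\<lambda>p M. sigma_letter lam mu p * M) [p] (1\<^sub>m 2)) (1, 0)) =
      act (lower (of_nat 1 * (if snd p then lam else - lam))) (1, 0)"
    by (simp add: act_mult act_one act_sigma_letter act_upper act_lower)
  then show ?case by (intro exI[of _ 1] exI[of _ "(1, 0)"]) simp
next
  case (Cons q w)
  let ?z = "act (foldr (\<lambda>p M. sigma_letter lam mu p * M) (q # w) (1\<^sub>m 2)) (1, 0)"
  let ?e = "if snd p then lam else - lam" and ?d = "if snd q then lam else - lam"
  from Cons.prems have "reduced (q # w)" and pq: "fst p = fst q \<Longrightarrow> snd p = snd q"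
    by (auto simp: reduced_def)
  from Cons.IH[OF this(1)] obtain k v where k: "1 \<le> k" and v: "cmod (snd v) < cmod (fst v)"
    and z: "act (upper (of_nat (fst q) * mu)) ?z = act (lower (of_nat k * ?d)) v" by blast
  have "act (foldr (\<lambda>p M. sigma_letter lam mu p * M) (p # q # w) (1\<^sub>m 2)) (1, 0) = act (sigma_letter lam mu p) ?z"
    by (simp add: act_mult mult_carrier_mat[of _ 2 2])
  then have eq: "act (upper (of_nat (fst p) * mu)) (act (foldr (\<lambda>p M. sigma_letter lam mu p * M) (p # q # w) (1\<^sub>m 2)) (1, 0)) =
      act (lower ?e) (act (upper (of_nat (fst p) * mu)) ?z)"
    by (simp add: act_sigma_letter act_upper_upper act_upper)
  show ?case
  proof (cases "fst p = fst q")
    case True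
    \<comment> \<open>Reducedness gives equal signs, so the two lower factors add up instead of
      cancelling.\<close>
    then have "?e = ?d" using pq by simp
    then have "act (lower ?e) (act (upper (of_nat (fst p) * mu)) ?z) = act (lower (of_nat (Suc k) * ?e)) v"
      unfolding True z by (simp add: act_lower_lower algebra_simps)
    then show ?thesis using eq v by (intro exI[of _ "Suc k"] exI[of _ v]) simp
  next
    case False
    let ?t = "(of_nat (fst p) - of_nat (fst q)) * mu"
    \<comment> \<open>The difference of distinct indices is a nonzero integer, hence of modulus at
      least 1, and \<open>?t\<close> has modulus at least 2.\<close>
    have "of_nat (fst p) - of_nat (fst q) = (of_int (int (fst p) - int (fst q)) :: complex)" by simp
    then have "1 \<le> cmod (of_nat (fst p) - of_nat (fst q))"
      using False by (simp only: norm_of_int)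
    then have t: "2 \<le> cmod ?t" by (rule two_le_cmod_mult[OF mu])
    have "2 \<le> cmod (of_nat k * ?d)"
      by (rule two_le_cmod_mult) (use lam k in auto)
    then have "cmod (fst (act (lower (of_nat k * ?d)) v)) < cmod (snd (act (lower (of_nat k * ?d)) v))"
      by (rule act_lower_pingpong[OF v])
    from act_upper_pingpong[OF this t]
    have "cmod (snd (act (upper ?t) (act (upper (of_nat (fst q) * mu)) ?z)))
        < cmod (fst (act (upper ?t) (act (upper (of_nat (fst q) * mu)) ?z)))"
      unfolding z .
    moreover have "act (upper ?t) (act (upper (of_nat (fst q) * mu)) ?z) = act (upper (of_nat (fst p) * mu)) ?z"
      unfolding act_upper_upper by (simp add: algebra_simps)
    ultimately show ?thesis
      unfolding eq by (intro exI[of _ 1] exI[of _ "act (upper (of_nat (fst p) * mu)) ?z"]) simp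
  qed
qed

section \<open>The homomorphism \<open>sigma\<close>: determinants and faithfulness\<close>

context odd_artin
begin

lemma sigma_hom: "sigma n lam mu \<in> hom F (GL 2 (adjoin {lam, mu}))"
  unfolding sigma_eq by (rule group.free_lift_hom[OF group_GL]) (simp add: sigma_letter_GL)

lemma sigma_group_hom: "group_hom F (GL 2 (adjoin {lam, mu})) (sigma n lam mu)"
  using F.is_group group_GL sigma_hom by (simp add: group_hom_def group_hom_axioms_def)

lemma sigma_carrier_mat [simp]: "c \<in> carrier F \<Longrightarrow> sigma n lam mu c \<in> carrier_mat 2 2"
  using group_hom.hom_closed[OF sigma_group_hom] GL_carrier_mat by blast

lemma sigma_mult: "c \<in> carrier F \<Longrightarrow> d \<in> carrier F \<Longrightarrow>
    sigma n lam mu (c \<otimes>\<^bsub>F\<^esub> d) = sigma n lam mu c * sigma n lam mu d"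
  using group_hom.hom_mult[OF sigma_group_hom] by simp

lemma sigma_one: "sigma n lam mu \<one>\<^bsub>F\<^esub> = 1\<^sub>m 2"
  using group_hom.hom_one[OF sigma_group_hom] by simp

lemma sigma_gen: "i < 2 * n \<Longrightarrow> sigma n lam mu (pres_gen {..<2 * n} {} i) = sigma_letter lam mu (i, True)"
  unfolding sigma_eq by (rule group.free_lift_gen[OF group_GL]) (simp_all add: sigma_letter_GL)

lemma det_sigma: "c \<in> carrier F \<Longrightarrow> det (sigma n lam mu c) = 1"
proof (induction rule: presented_group_induct)
  case one
  show ?case by (simp add: sigma_one)
next
  case (gen a c)
  then show ?case by (simp add: sigma_mult pres_gen_closed sigma_gen det_mult[of _ 2])
next
  case (inv_gen a c)
  then show ?case
    by (simp add: sigma_mult pres_gen_closed sigma_gen det_mult[of _ 2]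
      group_hom.hom_inv[OF sigma_group_hom] sigma_letter_inv)
qed

lemma sigma_faithful:
  assumes lam: "2 \<le> cmod lam" and mu: "2 \<le> cmod mu"
    and c: "c \<in> carrier F" "sigma n lam mu c = 1\<^sub>m 2"
  shows "c = \<one>\<^bsub>F\<^esub>"
proof -
  obtain w where w: "w \<in> words {..<2 * n}" "c = pres_rel {..<2 * n} {} `` {w}"
    using c(1) unfolding pres_carrier_iff by blast
  obtain r where r: "(w, r) \<in> pres_rel {..<2 * n} {}" "reduced r"
    using reduced_representative[OF w(1)] by blast
  have cr: "c = pres_rel {..<2 * n} {} `` {r}" and "r \<in> words {..<2 * n}"
    using w r(1) equiv_class_eq[OF equiv_pres_rel r(1)] pres_rel_words[OF r(1)] by simp_all
  then have "sigma n lam mu c = word_eval (GL 2 (adjoin {lam, mu})) (\<lambda>i. sigma_letter lam mu (i, True)) r"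
    unfolding sigma_eq cr by (intro group.pres_lift_class[OF group_GL]) (simp_all add: sigma_letter_GL)
  then have e: "foldr (\<lambda>p M. sigma_letter lam mu p * M) r (1\<^sub>m 2) = 1\<^sub>m 2"
    unfolding word_eval_sigma_letter c(2) by simp
  have "r = []"
  proof (cases r)
    case (Cons p r')
    from reduced_word_pingpong[OF lam mu r(2)[unfolded Cons]]
    obtain k v where k: "1 \<le> k" and v: "cmod (snd v) < cmod (fst v)"
      and eq: "act (upper (of_nat (fst p) * mu)) (1, 0) = act (lower (of_nat k * (if snd p then lam else - lam))) v"
      unfolding Cons[symmetric] e act_one by blast
    have "2 \<le> cmod (of_nat k * (if snd p then lam else - lam))"
      by (rule two_le_cmod_mult) (use lam k in auto)
    \<comment> \<open>The left side of \<open>eq\<close> is \<open>(1, 0)\<close>, whereas ping-pong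
      makes the second coordinate of the right side the larger one: a contradiction.\<close>
    from act_lower_pingpong[OF v this] show ?thesis
      unfolding eq[symmetric] by (simp add: act_upper)
  qed
  then show ?thesis using cr by (simp add: pres_one)
qed

end

section \<open>The representation of the Artin group\<close>

text \<open>Serves to turn a defining relation between words into an equation between elements of
  the presented group.\<close>

lemma word_eval_pres_gen:
  "w \<in> words S \<Longrightarrow> word_eval (presented_group S R) (pres_gen S R) w = pres_rel S R `` {w}"
proof (induction w rule: lists.induct)
  case Nil
  then show ?case by (simp add: word_eval_def pres_one)
next
  case (Cons p w)
  obtain a b where p: "p = (a, b)" by (cases p)
  have a: "[(a, b)] \<in> words S" "a \<in> S" using Cons.hyps p by auto
  have "(if b then pres_gen S R a else inv\<^bsub>presented_group S R\<^esub> pres_gen S R a) = pres_rel S R `` {[(a, b)]}"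
    using inv_pres_gen[OF a(2), of R] by (simp add: pres_gen_def)
  then show ?case
    using Cons.IH pres_mult_class[OF a(1) Cons.hyps(2), of R] p by (simp add: word_eval_def)
qed

lemma smult_smult_mat: "a \<cdot>\<^sub>m (b \<cdot>\<^sub>m M) = (a * b) \<cdot>\<^sub>m (M :: complex mat)"
  by (rule eq_matI) simp_all

lemma GL_smult:
  assumes M: "M \<in> carrier (GL m (adjoin A))" and t: "t \<in> adjoin A" "inverse t \<in> adjoin A" "t \<noteq> 0"
  shows "t \<cdot>\<^sub>m M \<in> carrier (GL m (adjoin A))"
proof -
  obtain M' where M': "M' \<in> carrier_mat m m" "elements_mat M' \<subseteq> adjoin A" "M * M' = 1\<^sub>m m" "M' * M = 1\<^sub>m m"
    and Mc: "M \<in> carrier_mat m m" "elements_mat M \<subseteq> adjoin A"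
    using M by (auto simp: GL_carrier_iff)
  have el: "elements_mat (u \<cdot>\<^sub>m B) \<subseteq> adjoin A"
    if "u \<in> adjoin A" "B \<in> carrier_mat m m" "elements_mat B \<subseteq> adjoin A" for u B
    using that adjoin_mult[of u A]
    by (auto simp: elements_mat_subset_iff[OF smult_carrier_mat[OF that(2)]] elements_mat_subset_iff[OF that(2)])
  have "(1 :: complex) \<cdot>\<^sub>m 1\<^sub>m m = 1\<^sub>m m"
    by (rule eq_matI) simp_all
  then have mul: "(t \<cdot>\<^sub>m M) * (inverse t \<cdot>\<^sub>m M') = 1\<^sub>m m" "(inverse t \<cdot>\<^sub>m M') * (t \<cdot>\<^sub>m M) = 1\<^sub>m m"
    using M' Mc t
    by (simp_all add: mult_smult_distrib[of _ m m _ m] mult_smult_assoc_mat[of _ m m _ m] smult_smult_mat)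
  show ?thesis
    unfolding GL_carrier_iff using M' Mc t mul el
    by (intro conjI bexI[of _ "inverse t \<cdot>\<^sub>m M'"] smult_carrier_mat) simp_all
qed

lemma block_mat_cong:
  assumes "\<And>i j. i < N \<Longrightarrow> j < N \<Longrightarrow> B i j = B' i j"
  shows "block_mat N B = block_mat N B'"
  unfolding block_mat_def by (rule cong_mat) (use assms in \<open>auto simp: less_mult_imp_div_less mult.commute\<close>)

context odd_artin
begin

text \<open>\<open>y x^-1\<close> is the image of \<open>x_0\<close>, and each conjugation by
  \<open>x\<close> applies \<open>chi\<close> once more. The group \<open>K\<close> is left general;
  the lemma is later used for the matrix group.\<close>

lemma conj_gen_image:
  assumes K: "group K" and \<phi>: "\<phi> \<in> hom F K" and x: "x \<in> carrier K"
    and shift: "\<And>g. g \<in> carrier F \<Longrightarrow> x \<otimes>\<^bsub>K\<^esub> \<phi> g = \<phi> (chi n g) \<otimes>\<^bsub>K\<^esub> x"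
    and y: "y = \<phi> (fgen n 0) \<otimes>\<^bsub>K\<^esub> x"
  shows "conj_gen K x y k = \<phi> (free_seq n k)"
proof -
  interpret \<phi>: group_hom F K \<phi>
    using F.is_group K \<phi> by (simp add: group_hom_def group_hom_axioms_def)
  have "x [^]\<^bsub>K\<^esub> k \<otimes>\<^bsub>K\<^esub> \<phi> (fgen n 0) = \<phi> (free_seq n k) \<otimes>\<^bsub>K\<^esub> x [^]\<^bsub>K\<^esub> k"
  proof (induction k)
    case 0
    then show ?case using n_pos by (simp add: free_seq_def)
  next
    case (Suc k)
    have [simp]: "fgen n 0 \<in> carrier F" using n_pos by simp
    have pow: "x [^]\<^bsub>K\<^esub> Suc k = x \<otimes>\<^bsub>K\<^esub> x [^]\<^bsub>K\<^esub> k" by (rule \<phi>.H.nat_pow_Suc2[OF x])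
    have "x [^]\<^bsub>K\<^esub> Suc k \<otimes>\<^bsub>K\<^esub> \<phi> (fgen n 0) = x \<otimes>\<^bsub>K\<^esub> (x [^]\<^bsub>K\<^esub> k \<otimes>\<^bsub>K\<^esub> \<phi> (fgen n 0))"
      unfolding pow using x by (simp add: \<phi>.H.m_assoc)
    also have "\<dots> = (x \<otimes>\<^bsub>K\<^esub> \<phi> (free_seq n k)) \<otimes>\<^bsub>K\<^esub> x [^]\<^bsub>K\<^esub> k"
      using x by (simp add: Suc \<phi>.H.m_assoc)
    also have "\<dots> = \<phi> (free_seq n (Suc k)) \<otimes>\<^bsub>K\<^esub> x [^]\<^bsub>K\<^esub> Suc k"
      unfolding pow using x by (simp add: shift chi_free_seq \<phi>.H.m_assoc)
    finally show ?case .
  qed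
  then show ?thesis
    using x n_pos by (simp add: conj_gen_def y \<phi>.H.m_assoc)
qed

text \<open>By \<open>artin_relation_iff\<close> the claim is the image under \<open>\<phi>\<close>
  of \<open>P_1 = P_0 x_(2n)\<close>.\<close>

lemma artin_relation_image:
  assumes K: "group K" and \<phi>: "\<phi> \<in> hom F K" and x: "x \<in> carrier K"
    and shift: "\<And>g. g \<in> carrier F \<Longrightarrow> x \<otimes>\<^bsub>K\<^esub> \<phi> g = \<phi> (chi n g) \<otimes>\<^bsub>K\<^esub> x"
    and y: "y = \<phi> (fgen n 0) \<otimes>\<^bsub>K\<^esub> x"
  shows "(x \<otimes>\<^bsub>K\<^esub> y) [^]\<^bsub>K\<^esub> n \<otimes>\<^bsub>K\<^esub> x = (y \<otimes>\<^bsub>K\<^esub> x) [^]\<^bsub>K\<^esub> n \<otimes>\<^bsub>K\<^esub> y"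
proof -
  interpret \<phi>: group_hom F K \<phi>
    using F.is_group K \<phi> by (simp add: group_hom_def group_hom_axioms_def)
  have yc: "y \<in> carrier K" using y x n_pos by simp
  have c: "conj_gen K x y k = \<phi> (free_seq n k)" for k
    by (rule conj_gen_image[OF assms])
  have p: "gprod K (map (\<lambda>j. \<phi> (free_seq n (k + 2 * j))) [0..<n]) = \<phi> (alt_prod n k)" for k
    unfolding alt_prod_def by (subst \<phi>.hom_gprod) (auto simp: comp_def)
  have "\<phi> (alt_prod n 1) = \<phi> (alt_prod n 0 \<otimes>\<^bsub>F\<^esub> free_seq n (2 * n))"
    using alt_prod_mult_free_seq[of 0] by simp
  then show ?thesis
    unfolding \<phi>.H.artin_relation_iff[OF x yc] c using p[of 0] p[of 1] by simp
qed

section \<open>The Artin group as the image of the free group times the powers of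
  \<open>ax\<close>\<close>

abbreviation A where "A \<equiv> artin_group n"

sublocale A: group A
  unfolding artin_group_def by (rule group_presented_group)

abbreviation (input) ax where "ax \<equiv> artin_x n"
abbreviation (input) ay where "ay \<equiv> artin_y n"

lemma artin_gens_closed [simp]: "ax \<in> carrier A" "ay \<in> carrier A"
  unfolding artin_x_def artin_y_def artin_group_def by (rule pres_gen_closed, simp)+

lemma artin_relation: "(ax \<otimes>\<^bsub>A\<^esub> ay) [^]\<^bsub>A\<^esub> n \<otimes>\<^bsub>A\<^esub> ax = (ay \<otimes>\<^bsub>A\<^esub> ax) [^]\<^bsub>A\<^esub> n \<otimes>\<^bsub>A\<^esub> ay"
proof -
  let ?S = "{GenX, GenY}" and ?R = "artin_rels n"
  let ?w = "\<lambda>a b :: artin_gen. concat (replicate n [(a, True), (b, True)]) @ [(a, True)]"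
  have words: "?w a b \<in> words ?S" for a b
    using artin_gen.exhaust by auto
  have S: "pres_gen ?S ?R a \<in> carrier A" for a
    unfolding artin_group_def by (rule pres_gen_closed) (cases a; simp)
  have "(?w GenX GenY, ?w GenY GenX) \<in> pres_rel ?S ?R"
    using pres_rel.relation[of "[]" ?S "[]" "?w GenX GenY" "?w GenY GenX" ?R] words by simp
  then have "word_eval A (pres_gen ?S ?R) (?w GenX GenY) = word_eval A (pres_gen ?S ?R) (?w GenY GenX)"
    unfolding artin_group_def word_eval_pres_gen[OF words] by (rule equiv_class_eq[OF equiv_pres_rel])
  then show ?thesis
    unfolding A.word_eval_alternating[where f = "pres_gen ?S ?R", OF S S] artin_x_def artin_y_def .
qed

definition embed :: "nat word set \<Rightarrow> artin_gen word set" where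
  "embed = pres_lift A (conj_gen A ax ay)"

lemma embed_hom: "embed \<in> hom F A"
  unfolding embed_def by (rule A.free_lift_hom) (simp add: A.conj_gen_closed)

sublocale embed: group_hom F A embed
  by unfold_locales (rule embed_hom)

lemma embed_gen: "i < 2 * n \<Longrightarrow> embed (fgen n i) = conj_gen A ax ay i"
  unfolding embed_def fgen_def by (rule A.free_lift_gen) (simp_all add: A.conj_gen_closed)

lemma conj_gen_Suc: "conj_gen A ax ay (Suc k) = ax \<otimes>\<^bsub>A\<^esub> conj_gen A ax ay k \<otimes>\<^bsub>A\<^esub> inv\<^bsub>A\<^esub> ax"
  unfolding conj_gen_def A.nat_pow_Suc2[OF artin_gens_closed(1)]
  by (simp add: A.inv_mult_group A.m_assoc)

text \<open>The defining relation enters here: it says that the conjugates satisfy the equation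
  \<open>P_0 x_(2n) = P_1\<close> that determines \<open>x_(2n)\<close> in the free group.\<close>

lemma embed_free_seq_2n: "embed (free_seq n (2 * n)) = conj_gen A ax ay (2 * n)"
proof -
  have e: "embed (alt_prod n k) = gprod A (map (\<lambda>j. conj_gen A ax ay (k + 2 * j)) [0..<n])" if "k \<le> 1" for k
    unfolding alt_prod_def using that
    by (subst embed.hom_gprod)
      (auto simp: free_seq_eq_fgen embed_gen intro!: arg_cong[where f = "gprod A"])
  have [simp]: "gprod A (map (\<lambda>j. conj_gen A ax ay (k + 2 * j)) [0..<n]) \<in> carrier A" for k
    by (simp add: A.conj_gen_closed)
  have "gprod A (map (\<lambda>j. conj_gen A ax ay (1 + 2 * j)) [0..<n]) =
      gprod A (map (\<lambda>j. conj_gen A ax ay (0 + 2 * j)) [0..<n]) \<otimes>\<^bsub>A\<^esub> conj_gen A ax ay (2 * n)"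
    using artin_relation unfolding A.artin_relation_iff[OF artin_gens_closed] by simp
  then show ?thesis
    unfolding free_seq_2n by (simp add: e A.conj_gen_closed)
qed

text \<open>On generators both \<open>chi\<close> and conjugation by \<open>ax\<close> raise the
  index by one; at the last generator this is \<open>embed_free_seq_2n\<close>.\<close>

lemma embed_chi:
  assumes "g \<in> carrier F"
  shows "ax \<otimes>\<^bsub>A\<^esub> embed g = embed (chi n g) \<otimes>\<^bsub>A\<^esub> ax"
proof -
  have "embed (chi n g) = ax \<otimes>\<^bsub>A\<^esub> embed g \<otimes>\<^bsub>A\<^esub> inv\<^bsub>A\<^esub> ax"
  proof (rule free_hom_eqI[where h = "\<lambda>g. embed (chi n g)" and h' = "\<lambda>g. ax \<otimes>\<^bsub>A\<^esub> embed g \<otimes>\<^bsub>A\<^esub> inv\<^bsub>A\<^esub> ax",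
        OF A.is_group _ _ _ assms])
    show "(\<lambda>g. embed (chi n g)) \<in> hom F A"
      using hom_compose[OF chi_hom embed_hom] by (simp add: comp_def)
    show "(\<lambda>g. ax \<otimes>\<^bsub>A\<^esub> embed g \<otimes>\<^bsub>A\<^esub> inv\<^bsub>A\<^esub> ax) \<in> hom F A"
      by (rule homI) (simp_all add: A.m_assoc)
    fix i assume i: "i < 2 * n"
    have "embed (free_seq n (Suc i)) = conj_gen A ax ay (Suc i)"
    proof (cases "Suc i < 2 * n")
      case True
      then show ?thesis by (simp add: free_seq_eq_fgen embed_gen)
    next
      case False
      then have "Suc i = 2 * n" using i by simp
      then show ?thesis using embed_free_seq_2n by simp
    qed
    then show "embed (chi n (fgen n i)) = ax \<otimes>\<^bsub>A\<^esub> embed (fgen n i) \<otimes>\<^bsub>A\<^esub> inv\<^bsub>A\<^esub> ax"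
      using i by (simp add: conj_gen_Suc embed_gen flip: chi_free_seq) (simp add: free_seq_eq_fgen)
  qed
  then show ?thesis
    using assms by (simp add: A.m_assoc)
qed

lemma embed_psi:
  assumes "g \<in> carrier F"
  shows "inv\<^bsub>A\<^esub> ax \<otimes>\<^bsub>A\<^esub> embed g = embed (psi n g) \<otimes>\<^bsub>A\<^esub> inv\<^bsub>A\<^esub> ax"
proof -
  have "embed g \<otimes>\<^bsub>A\<^esub> ax = ax \<otimes>\<^bsub>A\<^esub> embed (psi n g)"
    using embed_chi[of "psi n g"] assms by simp
  then have "inv\<^bsub>A\<^esub> ax \<otimes>\<^bsub>A\<^esub> (embed g \<otimes>\<^bsub>A\<^esub> ax) \<otimes>\<^bsub>A\<^esub> inv\<^bsub>A\<^esub> ax =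
      inv\<^bsub>A\<^esub> ax \<otimes>\<^bsub>A\<^esub> (ax \<otimes>\<^bsub>A\<^esub> embed (psi n g)) \<otimes>\<^bsub>A\<^esub> inv\<^bsub>A\<^esub> ax"
    by simp
  then show ?thesis using assms by (simp add: A.m_assoc)
qed

lemma artin_y_eq: "ay = embed (fgen n 0) \<otimes>\<^bsub>A\<^esub> ax"
  using n_pos by (simp add: embed_gen conj_gen_def A.m_assoc)

text \<open>Letters are multiplied on from the left: \<open>embed_chi\<close> and
  \<open>embed_psi\<close> carry \<open>ax\<close> and its inverse past \<open>embed g\<close>, and
  \<open>ay\<close> is \<open>embed (fgen n 0)\<close> times \<open>ax\<close>.\<close>

lemma artin_normal_form:
  assumes "c \<in> carrier A"
  shows "\<exists>g\<in>carrier F. \<exists>k::int. c = embed g \<otimes>\<^bsub>A\<^esub> ax [^]\<^bsub>A\<^esub> k"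
  using assms[unfolded artin_group_def]
proof (induction rule: presented_group_induct)
  case one
  have "\<one>\<^bsub>A\<^esub> = embed \<one>\<^bsub>F\<^esub> \<otimes>\<^bsub>A\<^esub> ax [^]\<^bsub>A\<^esub> (0::int)" by simp
  then show ?case unfolding artin_group_def[symmetric] by blast
next
  case (gen a c)
  then obtain g k where g: "g \<in> carrier F" and c: "c = embed g \<otimes>\<^bsub>A\<^esub> ax [^]\<^bsub>A\<^esub> (k::int)" by blast
  have x: "ax \<otimes>\<^bsub>A\<^esub> c = embed (chi n g) \<otimes>\<^bsub>A\<^esub> ax [^]\<^bsub>A\<^esub> (1 + k)"
    using g embed_chi[OF g] by (simp add: c A.int_pow_mult flip: A.m_assoc)
  have "ay \<otimes>\<^bsub>A\<^esub> c = embed (fgen n 0) \<otimes>\<^bsub>A\<^esub> (ax \<otimes>\<^bsub>A\<^esub> c)"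
    using g n_pos by (simp add: artin_y_eq c A.m_assoc)
  then have y: "ay \<otimes>\<^bsub>A\<^esub> c = embed (fgen n 0 \<otimes>\<^bsub>F\<^esub> chi n g) \<otimes>\<^bsub>A\<^esub> ax [^]\<^bsub>A\<^esub> (1 + k)"
    unfolding x using g n_pos by (simp add: A.m_assoc)
  have "chi n g \<in> carrier F" "fgen n 0 \<otimes>\<^bsub>F\<^esub> chi n g \<in> carrier F" using g n_pos by simp_all
  then show ?case
    using gen.hyps(1) x y unfolding artin_group_def[symmetric] artin_x_def artin_y_def by auto
next
  case (inv_gen a c)
  then obtain g k where g: "g \<in> carrier F" and c: "c = embed g \<otimes>\<^bsub>A\<^esub> ax [^]\<^bsub>A\<^esub> (k::int)" by blast
  have "inv\<^bsub>A\<^esub> ax \<otimes>\<^bsub>A\<^esub> ax [^]\<^bsub>A\<^esub> k = ax [^]\<^bsub>A\<^esub> (- 1 + k)"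
    by (subst A.int_pow_mult) (simp_all add: A.int_pow_neg)
  then have x': "inv\<^bsub>A\<^esub> ax \<otimes>\<^bsub>A\<^esub> (embed h \<otimes>\<^bsub>A\<^esub> ax [^]\<^bsub>A\<^esub> k) = embed (psi n h) \<otimes>\<^bsub>A\<^esub> ax [^]\<^bsub>A\<^esub> (- 1 + k)"
    if "h \<in> carrier F" for h
    using that embed_psi[OF that]
    by (simp flip: A.m_assoc) (simp add: A.m_assoc)
  have "inv\<^bsub>A\<^esub> ay \<otimes>\<^bsub>A\<^esub> c = inv\<^bsub>A\<^esub> ax \<otimes>\<^bsub>A\<^esub> (embed (inv\<^bsub>F\<^esub> (fgen n 0) \<otimes>\<^bsub>F\<^esub> g) \<otimes>\<^bsub>A\<^esub> ax [^]\<^bsub>A\<^esub> k)"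
    using g n_pos by (simp add: artin_y_eq c A.m_assoc A.inv_mult_group)
  also have "\<dots> = embed (psi n (inv\<^bsub>F\<^esub> (fgen n 0) \<otimes>\<^bsub>F\<^esub> g)) \<otimes>\<^bsub>A\<^esub> ax [^]\<^bsub>A\<^esub> (- 1 + k)"
    by (rule x') (use g n_pos in simp)
  finally have y: "inv\<^bsub>A\<^esub> ay \<otimes>\<^bsub>A\<^esub> c = \<dots>" .
  have "psi n g \<in> carrier F" "psi n (inv\<^bsub>F\<^esub> (fgen n 0) \<otimes>\<^bsub>F\<^esub> g) \<in> carrier F"
    using g n_pos by simp_all
  then show ?case
    using inv_gen.hyps(1) x'[OF g] y unfolding c artin_group_def[symmetric] artin_x_def artin_y_def by auto
qed

end

section \<open>The block matrices and the representation they define\<close>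

locale artin_rep = odd_artin +
  fixes lam mu s :: complex
  assumes s_nonzero: "s \<noteq> 0"
begin

abbreviation N where "N \<equiv> 4 * n + 2"
abbreviation R where "R \<equiv> adjoin {lam, mu, s, inverse s}"
abbreviation sg where "sg \<equiv> sigma n lam mu"
abbreviation corner where "corner \<equiv> s \<cdot>\<^sub>m sg (inv\<^bsub>F\<^esub> Sigma_elt n)"

definition H :: "complex mat monoid" where
  "H = GL (4 * (2 * n + 1)) R"

lemma H_eq: "H = GL (2 * N) R"
  unfolding H_def by (rule arg_cong2[where f = GL]) simp_all

lemma H_mult: "monoid.mult H = (*)"
  and H_one: "\<one>\<^bsub>H\<^esub> = 1\<^sub>m (2 * N)"
  unfolding H_eq by (rule GL_mult, rule GL_one)

text \<open>The matrix \<open>D(g)\<close> of the overview; because of the twist in block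
  \<open>i\<close>, moving on by one block amounts to applying \<open>chi\<close>.\<close>

definition diag_rep :: "nat word set \<Rightarrow> complex mat" where
  "diag_rep g = shift_mat N 0 (\<lambda>i. sg ((chi n ^^ i) g))"

sublocale H: group H
  unfolding H_def by (rule group_GL)

lemma sg_GL: "g \<in> carrier F \<Longrightarrow> sg g \<in> carrier (GL 2 R)"
  using group_hom.hom_closed[OF sigma_group_hom] GL_mono[OF adjoin_mono, of "{lam, mu}" "{lam, mu, s, inverse s}"]
  by blast

lemma corner_GL: "corner \<in> carrier (GL 2 R)"
  by (rule GL_smult[OF sg_GL]) (simp_all add: adjoin_incl s_nonzero)

lemma one_GL: "1\<^sub>m 2 \<in> carrier (GL 2 R)"
  using group.is_monoid[OF group_GL, THEN monoid.one_closed, of 2] by simp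

lemma shift_mat_GL_N:
  "(\<And>i. i < N \<Longrightarrow> d i \<in> carrier (GL 2 R)) \<Longrightarrow> k \<le> N \<Longrightarrow> shift_mat N k d \<in> carrier H"
  unfolding H_eq by (rule shift_mat_GL)

lemma rho_x_eq: "rho_x n lam mu s = shift_mat N 1 (\<lambda>i. if i = 4 * n + 1 then corner else 1\<^sub>m 2)"
  unfolding rho_x_def shift_mat_def
  by (rule block_mat_cong) (auto simp: mod_Suc)

lemma rho_x_closed: "rho_x n lam mu s \<in> carrier H"
  unfolding rho_x_eq by (rule shift_mat_GL_N) (simp_all add: corner_GL one_GL)

lemma diag_rep_closed: "g \<in> carrier F \<Longrightarrow> diag_rep g \<in> carrier H"
  unfolding diag_rep_def by (rule shift_mat_GL_N) (simp_all add: sg_GL chi_pow.hom_closed)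

lemma diag_rep_hom: "diag_rep \<in> hom F H"
proof (rule homI)
  fix g h assume gh: "g \<in> carrier F" "h \<in> carrier F"
  have "diag_rep g * diag_rep h = shift_mat N (0 + 0) (\<lambda>i. sg ((chi n ^^ i) g) * sg ((chi n ^^ ((i + 0) mod N)) h))"
    unfolding diag_rep_def by (rule shift_mat_mult) (simp_all add: gh chi_pow.hom_closed)
  also have "\<dots> = diag_rep (g \<otimes>\<^bsub>F\<^esub> h)"
    unfolding diag_rep_def by (rule shift_mat_cong) (simp_all add: gh sigma_mult chi_pow.hom_closed)
  finally show "diag_rep (g \<otimes>\<^bsub>F\<^esub> h) = diag_rep g \<otimes>\<^bsub>H\<^esub> diag_rep h"
    by (simp add: H_mult)
qed (rule diag_rep_closed)

sublocale diag: group_hom F H diag_rep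
  by unfold_locales (rule diag_rep_hom)

text \<open>In every block row but the last, both sides carry the image of
  \<open>chi^(i+1)(g)\<close>. In the last row the shift wraps around and the claim becomes
  \<open>Sigma^-1 g = chi^N(g) Sigma^-1\<close>, which is \<open>chi_pow_period\<close>; the scalar
  \<open>s\<close> commutes with everything.\<close>

lemma rho_x_diag_rep:
  assumes g: "g \<in> carrier F"
  shows "rho_x n lam mu s * diag_rep g = diag_rep (chi n g) * rho_x n lam mu s"
proof -
  let ?e = "\<lambda>i. if i = 4 * n + 1 then corner else 1\<^sub>m 2"
  let ?Si = "inv\<^bsub>F\<^esub> Sigma_elt n"
  have "rho_x n lam mu s * diag_rep g = shift_mat N (1 + 0) (\<lambda>i. ?e i * sg ((chi n ^^ ((i + 1) mod N)) g))"
    unfolding diag_rep_def rho_x_eq by (rule shift_mat_mult) (simp_all add: g chi_pow.hom_closed)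
  also have "\<dots> = shift_mat N (0 + 1) (\<lambda>i. sg ((chi n ^^ i) (chi n g)) * ?e ((i + 0) mod N))"
  proof (rule shift_mat_cong)
    fix i assume i: "i < N"
    have chi_Suc: "(chi n ^^ i) (chi n g) = (chi n ^^ Suc i) g" for i
      by (simp add: funpow_swap[of i "chi n" 1, simplified])
    show "?e i * sg ((chi n ^^ ((i + 1) mod N)) g) = sg ((chi n ^^ i) (chi n g)) * ?e ((i + 0) mod N)"
    proof (cases "i = 4 * n + 1")
      case True
      then have "(chi n ^^ i) (chi n g) = ?Si \<otimes>\<^bsub>F\<^esub> g \<otimes>\<^bsub>F\<^esub> Sigma_elt n"
        unfolding chi_Suc using chi_pow_period[OF g] by simp
      then have "sg ((chi n ^^ i) (chi n g)) * corner = s \<cdot>\<^sub>m sg (?Si \<otimes>\<^bsub>F\<^esub> g \<otimes>\<^bsub>F\<^esub> Sigma_elt n \<otimes>\<^bsub>F\<^esub> ?Si)"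
        using g by (simp add: mult_smult_distrib[of _ 2 2 _ 2] flip: sigma_mult)
      also have "?Si \<otimes>\<^bsub>F\<^esub> g \<otimes>\<^bsub>F\<^esub> Sigma_elt n \<otimes>\<^bsub>F\<^esub> ?Si = ?Si \<otimes>\<^bsub>F\<^esub> g"
        using g by (simp add: F.m_assoc)
      also have "s \<cdot>\<^sub>m sg (?Si \<otimes>\<^bsub>F\<^esub> g) = corner * sg g"
        using g by (simp add: sigma_mult mult_smult_assoc_mat[of _ 2 2 _ 2])
      finally show ?thesis using True by simp
    next
      case False
      then have "(i + 1) mod N = Suc i" "i mod N = i" using i by simp_all
      then show ?thesis
        using False i g chi_Suc[of i]
        by (simp add: chi_pow.hom_closed left_mult_one_mat[of _ 2 2] right_mult_one_mat[of _ 2 2])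
    qed
  qed simp
  also have "\<dots> = diag_rep (chi n g) * rho_x n lam mu s"
    unfolding diag_rep_def rho_x_eq
    by (rule shift_mat_mult[symmetric]) (simp_all add: g chi_pow.hom_closed)
  finally show ?thesis .
qed

text \<open>Above the diagonal the blocks agree because \<open>psi_inv\<close> is
  \<open>chi\<close>. The corner requires
  \<open>chi^(N-1)(x_0) Sigma^-1 = Sigma^-1 psi(x_0)\<close>.\<close>

lemma rho_y_eq: "rho_y n lam mu s = diag_rep (fgen n 0) * rho_x n lam mu s"
proof -
  let ?e = "\<lambda>i. if i = 4 * n + 1 then corner else 1\<^sub>m 2"
  let ?Si = "inv\<^bsub>F\<^esub> Sigma_elt n"
  have g: "fgen n 0 \<in> carrier F" using n_pos by simp
  have "rho_y n lam mu s = shift_mat N (0 + 1) (\<lambda>i. sg ((chi n ^^ i) (fgen n 0)) * ?e ((i + 0) mod N))"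
    unfolding rho_y_def shift_mat_def
  proof (rule block_mat_cong)
    fix i j assume ij: "i < N" "j < N"
    have "chi n ((chi n ^^ (4 * n + 1)) (fgen n 0)) = ?Si \<otimes>\<^bsub>F\<^esub> fgen n 0 \<otimes>\<^bsub>F\<^esub> Sigma_elt n"
      using chi_pow_period[OF g] by simp
    \<comment> \<open>Applying \<open>psi\<close> removes one \<open>chi\<close> from the full
      period, and it fixes \<open>Sigma_elt n\<close>.\<close>
    then have "psi n (chi n ((chi n ^^ (4 * n + 1)) (fgen n 0))) = psi n (?Si \<otimes>\<^bsub>F\<^esub> fgen n 0 \<otimes>\<^bsub>F\<^esub> Sigma_elt n)"
      by (rule arg_cong)
    then have chi_last: "(chi n ^^ (4 * n + 1)) (fgen n 0) = ?Si \<otimes>\<^bsub>F\<^esub> psi n (fgen n 0) \<otimes>\<^bsub>F\<^esub> Sigma_elt n"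
      using g by (simp only: psi_chi[OF chi_pow.hom_closed[OF g]]) (simp add: psi_Sigma)
    have "sg ((chi n ^^ (4 * n + 1)) (fgen n 0)) * corner =
        s \<cdot>\<^sub>m sg (?Si \<otimes>\<^bsub>F\<^esub> psi n (fgen n 0) \<otimes>\<^bsub>F\<^esub> Sigma_elt n \<otimes>\<^bsub>F\<^esub> ?Si)"
      unfolding chi_last using g by (simp add: mult_smult_distrib[of _ 2 2 _ 2] flip: sigma_mult)
    also have "?Si \<otimes>\<^bsub>F\<^esub> psi n (fgen n 0) \<otimes>\<^bsub>F\<^esub> Sigma_elt n \<otimes>\<^bsub>F\<^esub> ?Si = ?Si \<otimes>\<^bsub>F\<^esub> psi n (fgen n 0)"
      using g by (simp add: F.m_assoc)
    finally have last: "sg ((chi n ^^ (4 * n + 1)) (fgen n 0)) * corner = s \<cdot>\<^sub>m sg (?Si \<otimes>\<^bsub>F\<^esub> psi n (fgen n 0))" .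
    show "(if j = i + 1 then sg ((psi_inv n ^^ i) (fgen n 0))
        else if i = 4 * n + 1 \<and> j = 0 then s \<cdot>\<^sub>m sg (?Si \<otimes>\<^bsub>F\<^esub> psi n (fgen n 0)) else 0\<^sub>m 2 2) =
      (if j = (i + (0 + 1)) mod N then sg ((chi n ^^ i) (fgen n 0)) * ?e ((i + 0) mod N) else 0\<^sub>m 2 2)"
    proof (cases "i = 4 * n + 1")
      case True
      then have "(i + (0 + 1)) mod N = 0" "(i + 0) mod N = 4 * n + 1" by simp_all
      then show ?thesis using True ij last by simp
    next
      case False
      then have "(i + (0 + 1)) mod N = i + 1" "(i + 0) mod N = i" using ij by simp_all
      then show ?thesis
        using False g by (simp add: psi_inv_pow chi_pow.hom_closed right_mult_one_mat[of _ 2 2])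
    qed
  qed
  also have "\<dots> = diag_rep (fgen n 0) * rho_x n lam mu s"
    unfolding diag_rep_def rho_x_eq
    by (rule shift_mat_mult[symmetric]) (simp_all add: g chi_pow.hom_closed)
  finally show ?thesis .
qed

lemma rho_y_closed: "rho_y n lam mu s \<in> carrier H"
  using H.m_closed[OF diag_rep_closed rho_x_closed, of "fgen n 0"] n_pos by (simp add: rho_y_eq H_mult)

lemma rho_images_closed:
  "\<forall>g\<in>{GenX, GenY}. (case g of GenX \<Rightarrow> rho_x n lam mu s | GenY \<Rightarrow> rho_y n lam mu s) \<in> carrier H"
  by (simp add: rho_x_closed rho_y_closed)

lemma rho_images_relation:
  "\<forall>(l, r)\<in>artin_rels n. word_eval H (\<lambda>g. case g of GenX \<Rightarrow> rho_x n lam mu s | GenY \<Rightarrow> rho_y n lam mu s) l =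
    word_eval H (\<lambda>g. case g of GenX \<Rightarrow> rho_x n lam mu s | GenY \<Rightarrow> rho_y n lam mu s) r"
proof -
  have "(rho_x n lam mu s \<otimes>\<^bsub>H\<^esub> rho_y n lam mu s) [^]\<^bsub>H\<^esub> n \<otimes>\<^bsub>H\<^esub> rho_x n lam mu s =
      (rho_y n lam mu s \<otimes>\<^bsub>H\<^esub> rho_x n lam mu s) [^]\<^bsub>H\<^esub> n \<otimes>\<^bsub>H\<^esub> rho_y n lam mu s"
    by (rule artin_relation_image[OF H.is_group diag_rep_hom rho_x_closed])
      (simp_all add: rho_x_diag_rep rho_y_eq H_mult)
  then show ?thesis
    by (simp add: H.word_eval_alternating rho_x_closed rho_y_closed)
qed

lemma rho_hom: "rho n lam mu s \<in> hom (artin_group n) H"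
  unfolding rho_def artin_group_def H_def[symmetric] by (rule H.pres_lift_hom[OF rho_images_closed rho_images_relation])

lemma rho_artin_x: "rho n lam mu s (artin_x n) = rho_x n lam mu s"
  unfolding rho_def artin_x_def H_def[symmetric] by (subst H.pres_lift_gen[OF rho_images_closed rho_images_relation]) simp_all

lemma rho_artin_y: "rho n lam mu s (artin_y n) = rho_y n lam mu s"
  unfolding rho_def artin_y_def H_def[symmetric] by (subst H.pres_lift_gen[OF rho_images_closed rho_images_relation]) simp_all

sublocale rho: group_hom A H "rho n lam mu s"
  by unfold_locales (rule rho_hom)

text \<open>\<open>rho\<close> carries the conjugates in the Artin group to those formed from the
  two matrices, which \<open>conj_gen_image\<close> evaluates.\<close>

lemma rho_embed:
  assumes "g \<in> carrier F"
  shows "rho n lam mu s (embed g) = diag_rep g"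
proof (rule free_hom_eqI[where h = "\<lambda>g. rho n lam mu s (embed g)" and h' = diag_rep, OF H.is_group _ diag_rep_hom _ assms])
  show "(\<lambda>g. rho n lam mu s (embed g)) \<in> hom F H"
    using hom_compose[OF embed_hom rho_hom] by (simp add: comp_def)
  fix i assume i: "i < 2 * n"
  have "rho n lam mu s (embed (fgen n i)) = conj_gen H (rho_x n lam mu s) (rho_y n lam mu s) i"
    unfolding embed_gen[OF i] conj_gen_def
    by (simp add: rho_artin_x rho_artin_y rho.hom_nat_pow)
  also have "\<dots> = diag_rep (free_seq n i)"
    by (rule conj_gen_image[OF H.is_group diag_rep_hom rho_x_closed])
      (simp_all add: rho_x_diag_rep rho_y_eq H_mult)
  finally show "rho n lam mu s (embed (fgen n i)) = diag_rep (fgen n i)"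
    by (simp add: free_seq_eq_fgen i)
qed

text \<open>The \<open>q\<close>-th power of \<open>corner\<close>, with the scalar kept apart from
  the value of \<open>sg\<close> so that determinants can detect it.\<close>

definition corner_pow :: "nat \<Rightarrow> complex mat" where
  "corner_pow q = s ^ q \<cdot>\<^sub>m sg ((inv\<^bsub>F\<^esub> Sigma_elt n) [^]\<^bsub>F\<^esub> q)"

lemma corner_pow_carrier [simp]: "corner_pow q \<in> carrier_mat 2 2"
  by (simp add: corner_pow_def)

lemma det_corner_pow: "det (corner_pow q) = s ^ (2 * q)"
proof -
  have c: "(inv\<^bsub>F\<^esub> Sigma_elt n) [^]\<^bsub>F\<^esub> q \<in> carrier F" by simp
  show ?thesis
    unfolding corner_pow_def det_smult det_sigma[OF c] carrier_matD(2)[OF sigma_carrier_mat[OF c]]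
    by (simp add: mult.commute flip: power_mult)
qed

lemma corner_pow_0: "corner_pow 0 = 1\<^sub>m 2"
  unfolding corner_pow_def by (rule eq_matI) (simp_all add: sigma_one)

lemma corner_mult_pow: "corner * corner_pow q = corner_pow (Suc q)"
proof -
  let ?Si = "inv\<^bsub>F\<^esub> Sigma_elt n"
  have "?Si [^]\<^bsub>F\<^esub> Suc q = ?Si \<otimes>\<^bsub>F\<^esub> ?Si [^]\<^bsub>F\<^esub> q"
    by (rule F.nat_pow_Suc2) simp
  then show ?thesis
    unfolding corner_pow_def
    by (simp only: mult_smult_distrib[of _ 2 2 _ 2] mult_smult_assoc_mat[of _ 2 2 _ 2] smult_carrier_mat
      sigma_carrier_mat F.nat_pow_closed F.inv_closed Sigma_closed sigma_mult smult_smult_mat power_Suc2)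
qed

text \<open>The quotient \<open>(i + m) div N\<close> counts how often \<open>m\<close> steps
  starting at block row \<open>i\<close> wrap around; each time contributes one factor
  \<open>corner\<close>.\<close>

lemma rho_x_pow: "rho_x n lam mu s [^]\<^bsub>H\<^esub> m = shift_mat N m (\<lambda>i. corner_pow ((i + m) div N))"
proof (induction m)
  case 0
  have "rho_x n lam mu s [^]\<^bsub>H\<^esub> (0::nat) = shift_mat N 0 (\<lambda>_. 1\<^sub>m 2)"
    by (simp only: nat_pow_0 H_one shift_mat_one)
  also have "\<dots> = shift_mat N 0 (\<lambda>i. corner_pow ((i + 0) div N))"
    by (rule shift_mat_cong) (simp_all add: corner_pow_0)
  finally show ?case .
next
  case (Suc m)
  let ?e = "\<lambda>i. if i = 4 * n + 1 then corner else 1\<^sub>m 2"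
  have "rho_x n lam mu s [^]\<^bsub>H\<^esub> Suc m = rho_x n lam mu s * rho_x n lam mu s [^]\<^bsub>H\<^esub> m"
    using H.nat_pow_Suc2[OF rho_x_closed] by (simp add: H_mult)
  also have "\<dots> = shift_mat N (1 + m) (\<lambda>i. ?e i * corner_pow (((i + 1) mod N + m) div N))"
    unfolding Suc unfolding rho_x_eq by (rule shift_mat_mult) simp_all
  also have "\<dots> = shift_mat N (Suc m) (\<lambda>i. corner_pow ((i + Suc m) div N))"
  proof (rule shift_mat_cong)
    fix i assume i: "i < N"
    show "?e i * corner_pow (((i + 1) mod N + m) div N) = corner_pow ((i + Suc m) div N)"
    proof (cases "i = 4 * n + 1")
      case True
      then have "i + Suc m = m + N" "(i + 1) mod N = 0" by simp_all
      moreover have "(m + N) div N = Suc (m div N)" using div_add_self2[of N m] by simp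
      ultimately have "(i + Suc m) div N = Suc (m div N)" "((i + 1) mod N + m) div N = m div N"
        by (simp_all only: add_0)
      then show ?thesis using True by (simp only: corner_mult_pow simp_thms if_True)
    next
      case False
      then show ?thesis using i by (simp add: left_mult_one_mat[of _ 2 2])
    qed
  qed simp
  finally show ?case .
qed

section \<open>Faithfulness\<close>

context
  assumes lam: "2 \<le> cmod lam" and mu: "2 \<le> cmod mu" and s_pow: "\<And>k::nat. 0 < k \<Longrightarrow> s ^ k \<noteq> 1"
begin

lemma diag_rep_mult_rho_x_pow:
  assumes g: "g \<in> carrier F" and eq: "diag_rep g * rho_x n lam mu s [^]\<^bsub>H\<^esub> (m::nat) = 1\<^sub>m (2 * N)"
  shows "g = \<one>\<^bsub>F\<^esub> \<and> m = 0"
proof -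
  have "diag_rep g * rho_x n lam mu s [^]\<^bsub>H\<^esub> m =
      shift_mat N (0 + m) (\<lambda>i. sg ((chi n ^^ i) g) * corner_pow (((i + 0) mod N + m) div N))"
    unfolding rho_x_pow diag_rep_def by (rule shift_mat_mult) (simp_all add: g chi_pow.hom_closed)
  then have e: "shift_mat N (0 + m) (\<lambda>i. sg ((chi n ^^ i) g) * corner_pow (((i + 0) mod N + m) div N)) = 1\<^sub>m (2 * N)"
    using eq by (simp only:)
  have m: "(0 + m) mod N = 0"
    and gm: "sg ((chi n ^^ 0) g) * corner_pow (((0 + 0) mod N + m) div N) = 1\<^sub>m 2"
    using shift_mat_eq_oneD[OF e] g by (simp_all add: mult_carrier_mat[of _ 2 2])
  then have gm: "sg g * corner_pow (m div N) = 1\<^sub>m 2" by simp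
  then have "det (sg g * corner_pow (m div N)) = 1" by simp
  \<comment> \<open>Values of \<open>sg\<close> have determinant 1, so only the scalar remains,
    squared because the blocks are 2 by 2.\<close>
  then have "s ^ (2 * (m div N)) = 1"
    using g by (simp add: det_mult[of _ 2] det_sigma det_corner_pow)
  then have q: "m div N = 0"
    using s_pow[of "2 * (m div N)"] by auto
  then have "m = 0" using m by (metis add_0 div_mult_mod_eq mult_0)
  moreover have "sg g = 1\<^sub>m 2" using gm q g by (simp add: corner_pow_0 right_mult_one_mat[of _ 2 2])
  then have "g = \<one>\<^bsub>F\<^esub>" by (rule sigma_faithful[OF lam mu g])
  ultimately show ?thesis by simp
qed

lemma rho_inj: "inj_on (rho n lam mu s) (carrier A)"
proof -
  have "c = \<one>\<^bsub>A\<^esub>" if c: "c \<in> carrier A" "rho n lam mu s c = \<one>\<^bsub>H\<^esub>" for c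
  proof -
    let ?x = "rho_x n lam mu s"
    obtain g and k :: int where g: "g \<in> carrier F" and cg: "c = embed g \<otimes>\<^bsub>A\<^esub> artin_x n [^]\<^bsub>A\<^esub> k"
      using artin_normal_form[OF c(1)] by blast
    have e: "diag_rep g \<otimes>\<^bsub>H\<^esub> ?x [^]\<^bsub>H\<^esub> k = \<one>\<^bsub>H\<^esub>"
      using c(2) g unfolding cg
      by (simp add: rho.hom_int_pow rho_artin_x rho_embed)
    have "g = \<one>\<^bsub>F\<^esub> \<and> k = 0"
    proof (cases "0 \<le> k")
      case True
      then obtain m where m: "k = int m" by (metis nonneg_int_cases)
      then have "diag_rep g * ?x [^]\<^bsub>H\<^esub> m = 1\<^sub>m (2 * N)" using e by (simp only: int_pow_int H_mult H_one)
      from diag_rep_mult_rho_x_pow[OF g this] show ?thesis using m by simp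
    next
      case False
      then obtain m where m: "k = - int m" by (metis int_cases2 of_nat_0_le_iff)
      have "?x [^]\<^bsub>H\<^esub> k = inv\<^bsub>H\<^esub> (?x [^]\<^bsub>H\<^esub> m)"
        unfolding m by (rule H.int_pow_neg_int[OF rho_x_closed])
      \<comment> \<open>For a negative exponent the power is moved to the other side, and the
        nonnegative case is then applied to the inverse of \<open>g\<close>.\<close>
      then have "diag_rep g = ?x [^]\<^bsub>H\<^esub> m"
        using e g rho_x_closed H.inv_equality[of "diag_rep g" "inv\<^bsub>H\<^esub> (?x [^]\<^bsub>H\<^esub> m)"]
        by (simp add: diag_rep_closed)
      then have "diag_rep (inv\<^bsub>F\<^esub> g) \<otimes>\<^bsub>H\<^esub> ?x [^]\<^bsub>H\<^esub> m = \<one>\<^bsub>H\<^esub>"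
        using g by (simp add: rho_x_closed)
      then have "inv\<^bsub>F\<^esub> g = \<one>\<^bsub>F\<^esub> \<and> m = 0"
        by (intro diag_rep_mult_rho_x_pow) (simp_all only: H_mult H_one F.inv_closed g)
      then show ?thesis using m g by simp
    qed
    then show ?thesis using cg by simp
  qed
  then show ?thesis
    by (simp add: rho.inj_on_one_iff)
qed

end

end

theorem proposition3:
  fixes n :: nat and lam mu s :: complex
  assumes "n \<ge> 1" and "s \<noteq> 0"
  shows "rho n lam mu s \<in> hom (artin_group n) (GL (4 * (2 * n + 1)) (adjoin {lam, mu, s, inverse s}))
    \<and> rho n lam mu s (artin_x n) = rho_x n lam mu s
    \<and> rho n lam mu s (artin_y n) = rho_y n lam mu s
    \<and> (cmod lam \<ge> 2 \<and> cmod mu \<ge> 2 \<and> (\<nexists>k::nat. k > 0 \<and> s ^ k = 1)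
        \<longrightarrow> inj_on (rho n lam mu s) (carrier (artin_group n)))"
proof -
  interpret artin_rep n lam mu s by unfold_locales (fact assms)+
  show ?thesis
    using rho_hom[unfolded H_def] rho_artin_x rho_artin_y rho_inj by blast
qed

end
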